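(* Let $H$ be a complex Hilbert space and let $f:[0,\infty)\to\mathbb{R}$ be a continuous convex function that is normalized, i.e. $f(1)=0$. Then for any $Q,P\in S_1(H)$ with $P$ invertible, we have $$0\le S_f(Q,P).$$ Moreover, if $f$ is continuously differentiable, then also $$S_f(Q,P)\le S_{\ell f'}(Q,P)-S_{f'}(Q,P),$$ where $\ell(t)=t$, $t\in\mathbb{R}$ (so $(\ell f')(t)=t f'(t)$).
   Context: $H$ is a complex Hilbert space; $\mathcal{B}_1(H)$ and $\mathcal{B}_2(H)$ denote the trace class and Hilbert–Schmidt operators on $H$; $\mathcal{B}_2(H)$ is a Hilbert space with inner product $\langle U,V\rangle_2=\operatorname{tr}(V^*U)$. $S_1(H):=\{P\in\mathcal{B}_1(H): P\ge 0,\ \operatorname{tr}(P)=1\}$. For $Q,P\in S_1(H)$ with $P$ invertible, the Araki transform is the positive bounded selfadjoint operator $\mathfrak{A}_{Q,P}$ on $\mathcal{B}_2(H)$ given by $\mathfrak{A}_{Q,P}T:=QTP^{-1}$. For a continuous function $g:[0,\infty)\to\mathbb{R}$, with $g(\mathfrak{A}_{Q,P})$ defined by the continuous functional calculus, the quantum $g$-divergence is $S_g(Q,P):=\langle g(\mathfrak{A}_{Q,P})P^{1/2},P^{1/2}\rangle_2$. *)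

theory Defs
  imports "HOL-Analysis.Analysis"
begin

section \<open>Complex Hilbert spaces\<close>

class complex_vector = real_vector +
  fixes scaleC :: "complex \<Rightarrow> 'a \<Rightarrow> 'a"  (infixr \<open>*\<^sub>C\<close> 75)
  assumes scaleC_add_right: "c *\<^sub>C (x + y) = c *\<^sub>C x + c *\<^sub>C y"
    and scaleC_add_left: "(c + d) *\<^sub>C x = c *\<^sub>C x + d *\<^sub>C x"
    and scaleC_scaleC: "c *\<^sub>C (d *\<^sub>C x) = (c * d) *\<^sub>C x"
    and scaleR_scaleC: "r *\<^sub>R x = complex_of_real r *\<^sub>C x"

text \<open>The complex inner product is linear in its \<^emph>\<open>first\<close> argument. The norm is the one
  inherited from \<^class>\<open>real_inner\<close>, so \<open>norm x = sqrt (Re (cinner x x))\<close>.\<close>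

class complex_hilbert_space = complex_vector + real_inner + complete_space +
  fixes cinner :: "'a \<Rightarrow> 'a \<Rightarrow> complex"
  assumes cinner_commute: "cinner x y = cnj (cinner y x)"
    and cinner_add_left: "cinner (x + y) z = cinner x z + cinner y z"
    and cinner_scaleC_left: "cinner (c *\<^sub>C x) y = c * cinner x y"
    and inner_eq_Re_cinner: "inner x y = Re (cinner x y)"

lemma norm_scaleC:
  fixes x :: "'a :: complex_hilbert_space"
  shows "norm (c *\<^sub>C x) = cmod c * norm x"
proof -
  have right: "cinner y (c *\<^sub>C x) = cnj c * cinner y x" for y :: 'a
    by (metis cinner_commute cinner_scaleC_left complex_cnj_mult)
  have "cinner (c *\<^sub>C x) (c *\<^sub>C x) = (c * cnj c) * cinner x x"
    by (simp add: cinner_scaleC_left right)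
  also have "c * cnj c = complex_of_real ((cmod c)\<^sup>2)"
    by (simp only: complex_norm_square)
  finally have "inner (c *\<^sub>C x) (c *\<^sub>C x) = (cmod c)\<^sup>2 * inner x x"
    by (simp add: inner_eq_Re_cinner)
  then show ?thesis
    by (simp add: norm_eq_sqrt_inner real_sqrt_mult)
qed

lemma bounded_linear_scaleC:
  "bounded_linear (\<lambda>x :: 'a :: complex_hilbert_space. c *\<^sub>C x)"
  by (rule bounded_linear_intro[where K = "cmod c"])
    (simp_all add: scaleC_add_right scaleR_scaleC scaleC_scaleC norm_scaleC mult.commute)

instantiation blinfun :: (real_normed_vector, complex_hilbert_space) complex_vector
begin

lift_definition scaleC_blinfun :: "complex \<Rightarrow> ('a \<Rightarrow>\<^sub>L 'b) \<Rightarrow> ('a \<Rightarrow>\<^sub>L 'b)"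
  is "\<lambda>c T x. c *\<^sub>C T x"
  by (rule bounded_linear_compose[OF bounded_linear_scaleC])

instance
  by standard
    (transfer; simp add: scaleC_add_right scaleC_add_left scaleC_scaleC scaleR_scaleC)+

end


section \<open>Bounded operators on a complex Hilbert space\<close>

text \<open>Elements of \<^typ>\<open>'a \<Rightarrow>\<^sub>L 'a\<close> are only real linear; \<open>B(H)\<close> consists of the complex linear ones.\<close>

definition bounded_ops :: "('a :: complex_hilbert_space \<Rightarrow>\<^sub>L 'a) set"
  where "bounded_ops = {T. \<forall>c x. blinfun_apply T (c *\<^sub>C x) = c *\<^sub>C blinfun_apply T x}"

definition adj :: "('a :: complex_hilbert_space \<Rightarrow>\<^sub>L 'a) \<Rightarrow> ('a \<Rightarrow>\<^sub>L 'a)"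
  where "adj T = (THE S. \<forall>x y. cinner (blinfun_apply T x) y = cinner x (blinfun_apply S y))"

text \<open>The order on \<^typ>\<open>complex\<close> is that of \<^theory>\<open>HOL-Library.Complex_Order\<close>, so \<open>0 \<le> z\<close> means
  that \<open>z\<close> is real and nonnegative.\<close>

definition positive_op :: "('a :: complex_hilbert_space \<Rightarrow>\<^sub>L 'a) \<Rightarrow> bool"
  where "positive_op T \<longleftrightarrow> T \<in> bounded_ops \<and> (\<forall>x. 0 \<le> cinner (blinfun_apply T x) x)"

definition sqrt_op :: "('a :: complex_hilbert_space \<Rightarrow>\<^sub>L 'a) \<Rightarrow> ('a \<Rightarrow>\<^sub>L 'a)"
  where "sqrt_op T = (THE R. positive_op R \<and> R o\<^sub>L R = T)"

definition abs_op :: "('a :: complex_hilbert_space \<Rightarrow>\<^sub>L 'a) \<Rightarrow> ('a \<Rightarrow>\<^sub>L 'a)"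
  where "abs_op T = sqrt_op (adj T o\<^sub>L T)"

definition is_inverse_op :: "('a :: complex_hilbert_space \<Rightarrow>\<^sub>L 'a) \<Rightarrow> ('a \<Rightarrow>\<^sub>L 'a) \<Rightarrow> bool"
  where "is_inverse_op T S \<longleftrightarrow> S \<in> bounded_ops \<and> T o\<^sub>L S = id_blinfun \<and> S o\<^sub>L T = id_blinfun"

definition invertible_op :: "('a :: complex_hilbert_space \<Rightarrow>\<^sub>L 'a) \<Rightarrow> bool"
  where "invertible_op T \<longleftrightarrow> (\<exists>S. is_inverse_op T S)"

definition inv_op :: "('a :: complex_hilbert_space \<Rightarrow>\<^sub>L 'a) \<Rightarrow> ('a \<Rightarrow>\<^sub>L 'a)"
  where "inv_op T = (THE S. is_inverse_op T S)"


section \<open>Trace class and Hilbert--Schmidt operators\<close>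

text \<open>An orthonormal basis is a maximal orthonormal set. None of the notions below depends on
  the choice of the basis.\<close>

definition is_onb :: "'a :: complex_hilbert_space set \<Rightarrow> bool"
  where "is_onb E \<longleftrightarrow>
    (\<forall>e\<in>E. \<forall>e'\<in>E. cinner e e' = (if e = e' then 1 else 0)) \<and>
    (\<forall>x. (\<forall>e\<in>E. cinner x e = 0) \<longrightarrow> x = 0)"

definition trace_class :: "('a :: complex_hilbert_space \<Rightarrow>\<^sub>L 'a) set"
  where "trace_class = {T \<in> bounded_ops.
    \<exists>E. is_onb E \<and> (\<lambda>e. cinner (blinfun_apply (abs_op T) e) e) summable_on E}"

definition hilbert_schmidt :: "('a :: complex_hilbert_space \<Rightarrow>\<^sub>L 'a) set"
  where "hilbert_schmidt = {T \<in> bounded_ops.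
    \<exists>E. is_onb E \<and> (\<lambda>e. (norm (blinfun_apply T e))\<^sup>2) summable_on E}"

definition tr :: "('a :: complex_hilbert_space \<Rightarrow>\<^sub>L 'a) \<Rightarrow> complex"
  where "tr T = (\<Sum>\<^sub>\<infinity>e\<in>(SOME E. is_onb E). cinner (blinfun_apply T e) e)"

definition hs_inner :: "('a :: complex_hilbert_space \<Rightarrow>\<^sub>L 'a) \<Rightarrow> ('a \<Rightarrow>\<^sub>L 'a) \<Rightarrow> complex"
  where "hs_inner U V = tr (adj V o\<^sub>L U)"

definition hs_norm :: "('a :: complex_hilbert_space \<Rightarrow>\<^sub>L 'a) \<Rightarrow> real"
  where "hs_norm T = sqrt (Re (hs_inner T T))"

definition density_ops :: "('a :: complex_hilbert_space \<Rightarrow>\<^sub>L 'a) set"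
  where "density_ops = {P \<in> trace_class. positive_op P \<and> tr P = 1}"


section \<open>Continuous functional calculus\<close>

text \<open>The following notions concern operators on a complex normed space that is given by a
  subspace \<open>V\<close> of a \<^class>\<open>complex_vector\<close> type and a norm \<open>N\<close> on \<open>V\<close>. They are used for the
  Hilbert space of Hilbert--Schmidt operators, whose norm is not the one of the type
  \<^typ>\<open>'a \<Rightarrow>\<^sub>L 'a\<close>. Operators on \<open>V\<close> are extensional functions, which makes them unique.\<close>

definition bounded_ops_on ::
    "'v :: complex_vector set \<Rightarrow> ('v \<Rightarrow> real) \<Rightarrow> ('v \<Rightarrow> 'v) set"
  where "bounded_ops_on V N = {A \<in> V \<rightarrow>\<^sub>E V.
    (\<forall>x\<in>V. \<forall>y\<in>V. A (x + y) = A x + A y) \<and>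
    (\<forall>c. \<forall>x\<in>V. A (c *\<^sub>C x) = c *\<^sub>C A x) \<and>
    (\<exists>K. \<forall>x\<in>V. N (A x) \<le> K * N x)}"

definition spectrum_on ::
    "'v :: complex_vector set \<Rightarrow> ('v \<Rightarrow> real) \<Rightarrow> ('v \<Rightarrow> 'v) \<Rightarrow> complex set"
  where "spectrum_on V N A = {z. \<not> (\<exists>B\<in>bounded_ops_on V N. \<forall>x\<in>V.
    A (B x) - z *\<^sub>C B x = x \<and> B (A x - z *\<^sub>C x) = x)}"

definition poly_op_on ::
    "'v :: complex_vector set \<Rightarrow> real poly \<Rightarrow> ('v \<Rightarrow> 'v) \<Rightarrow> ('v \<Rightarrow> 'v)"
  where "poly_op_on V p A = (\<lambda>x\<in>V. \<Sum>i\<le>degree p. coeff p i *\<^sub>R (A ^^ i) x)"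

definition op_norm_tendsto ::
    "'v :: complex_vector set \<Rightarrow> ('v \<Rightarrow> real) \<Rightarrow> (nat \<Rightarrow> 'v \<Rightarrow> 'v) \<Rightarrow> ('v \<Rightarrow> 'v) \<Rightarrow> bool"
  where "op_norm_tendsto V N F B \<longleftrightarrow>
    (\<forall>\<epsilon>>0. \<forall>\<^sub>F n in sequentially. \<forall>x\<in>V. N (F n x - B x) \<le> \<epsilon> * N x)"

text \<open>For a bounded selfadjoint operator \<open>A\<close> on a Hilbert space, whose spectrum is real, and a
  real function \<open>g\<close> that is continuous on the spectrum, \<open>g(A)\<close> is the limit in operator norm
  of \<open>p\<^sub>n(A)\<close> for real polynomials \<open>p\<^sub>n\<close> converging to \<open>g\<close> uniformly on the spectrum. By the
  Weierstrass theorem such \<open>p\<^sub>n\<close> exist, and the limit does not depend on them.\<close>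

definition cfc_on ::
    "'v :: complex_vector set \<Rightarrow> ('v \<Rightarrow> real) \<Rightarrow> (real \<Rightarrow> real) \<Rightarrow> ('v \<Rightarrow> 'v) \<Rightarrow> ('v \<Rightarrow> 'v)"
  where "cfc_on V N g A = (THE B. B \<in> bounded_ops_on V N \<and>
    (\<exists>p :: nat \<Rightarrow> real poly.
      uniform_limit {t. complex_of_real t \<in> spectrum_on V N A} (\<lambda>n. poly (p n)) g sequentially \<and>
      op_norm_tendsto V N (\<lambda>n. poly_op_on V (p n) A) B))"


section \<open>Araki transform and quantum divergence\<close>

definition araki ::
    "('a :: complex_hilbert_space \<Rightarrow>\<^sub>L 'a) \<Rightarrow> ('a \<Rightarrow>\<^sub>L 'a) \<Rightarrow> ('a \<Rightarrow>\<^sub>L 'a) \<Rightarrow> ('a \<Rightarrow>\<^sub>L 'a)"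
  where "araki Q P = (\<lambda>T\<in>hilbert_schmidt. Q o\<^sub>L T o\<^sub>L inv_op P)"

definition quantum_divergence ::
    "(real \<Rightarrow> real) \<Rightarrow> ('a :: complex_hilbert_space \<Rightarrow>\<^sub>L 'a) \<Rightarrow> ('a \<Rightarrow>\<^sub>L 'a) \<Rightarrow> complex"
  where "quantum_divergence g Q P =
    hs_inner (cfc_on hilbert_schmidt hs_norm g (araki Q P) (sqrt_op P)) (sqrt_op P)"

end

theory Submission
  imports Defs
begin

text \<open>An invertible operator of finite trace exists only in finite dimension, so \<open>Q\<close> and \<open>P\<close> have
  finite orthonormal bases \<open>E\<close> and \<open>F\<close> of eigenvectors, with eigenvalues \<open>q e \<ge> 0\<close> and \<open>p f > 0\<close>.
  The operators \<open>x \<mapsto> \<langle>x, f\<rangle> e\<close> then diagonalize the Araki transform with eigenvalues \<open>q e / p f\<close>,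
  and \<open>S\<^sub>g(Q, P)\<close> is the sum of \<open>w e f * g (q e / p f)\<close> with weights
  \<open>w e f = p f * \<bar>\<langle>f, e\<rangle>\<bar>\<^sup>2\<close>. The weights have sum \<open>tr P = 1\<close>, and the ratios have mean
  \<open>tr Q = 1\<close>. Nonnegativity is Jensen's inequality, and the upper bound is the mean of the tangent
  inequality \<open>f t = f t - f 1 \<le> f' t * (t - 1)\<close>.\<close>

section \<open>Complex inner products\<close>

lemma scaleC_one [simp]: "1 *\<^sub>C (x :: 'a :: complex_vector) = x"
  using scaleR_scaleC[of 1 x] by simp

lemma scaleC_zero_left [simp]: "0 *\<^sub>C (x :: 'a :: complex_vector) = 0"
  using scaleR_scaleC[of 0 x] by simp

lemma scaleC_zero_right [simp]: "c *\<^sub>C (0 :: 'a :: complex_vector) = 0"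
  using scaleC_add_right[of c 0 "0 :: 'a"] by simp

lemma scaleC_minus_left: "(- c) *\<^sub>C (x :: 'a :: complex_vector) = - (c *\<^sub>C x)"
  using scaleC_add_left[of c "- c" x] by (simp add: eq_neg_iff_add_eq_0 add.commute)

lemma cinner_add_right:
  "cinner x (y + z) = cinner x y + cinner x (z :: 'a :: complex_hilbert_space)"
  by (metis cinner_add_left cinner_commute complex_cnj_add)

lemma cinner_scaleC_right:
  "cinner x (c *\<^sub>C y) = cnj c * cinner x (y :: 'a :: complex_hilbert_space)"
  by (metis cinner_commute cinner_scaleC_left complex_cnj_mult)

lemma cinner_scaleR_left:
  "cinner (r *\<^sub>R x) y = complex_of_real r * cinner x (y :: 'a :: complex_hilbert_space)"
  by (simp add: scaleR_scaleC cinner_scaleC_left)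

lemma cinner_zero_left [simp]: "cinner 0 (y :: 'a :: complex_hilbert_space) = 0"
  using cinner_scaleC_left[of 0 0 y] by simp

lemma cinner_diff_left:
  "cinner (x - y) z = cinner x z - cinner y (z :: 'a :: complex_hilbert_space)"
  using cinner_add_left[of "x - y" y z] by simp

lemma cinner_sum_left:
  "cinner (\<Sum>i\<in>I. f i) z = (\<Sum>i\<in>I. cinner (f i) (z :: 'a :: complex_hilbert_space))"
  by (induction I rule: infinite_finite_induct) (simp_all add: cinner_add_left)

lemma cinner_self:
  "cinner x (x :: 'a :: complex_hilbert_space) = complex_of_real ((norm x)\<^sup>2)"
proof (rule complex_eqI)
  show "Re (cinner x x) = Re (complex_of_real ((norm x)\<^sup>2))"
    by (simp add: power2_norm_eq_inner inner_eq_Re_cinner)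
  show "Im (cinner x x) = Im (complex_of_real ((norm x)\<^sup>2))"
    using arg_cong[OF cinner_commute[of x x], of Im] by simp
qed

lemma cinner_eqI:
  assumes "\<And>z. cinner x z = cinner y (z :: 'a :: complex_hilbert_space)"
  shows "x = y"
  using assms[of "x - y"] cinner_self[of "x - y"] by (simp add: cinner_diff_left)

text \<open>Multiplying \<open>x\<close> by a number of modulus one makes the inner product real and
  nonnegative without changing the norm of \<open>x\<close>. The Cauchy-Schwarz inequality of the
  real inner product then applies.\<close>

lemma cmod_cinner_le: "cmod (cinner x y) \<le> norm x * norm (y :: 'a :: complex_hilbert_space)"
proof (cases "cinner x y = 0")
  case False
  define c where "c = cnj (cinner x y) / cmod (cinner x y)"
  have "c * cinner x y = cmod (cinner x y)"
    using False complex_norm_square[of "cinner x y"]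
    by (simp add: c_def power2_eq_square field_simps)
  then have "cmod (cinner x y) = inner (c *\<^sub>C x) y"
    by (simp add: inner_eq_Re_cinner cinner_scaleC_left)
  also have "\<dots> \<le> norm (c *\<^sub>C x) * norm y"
    by (rule norm_cauchy_schwarz)
  also have "norm (c *\<^sub>C x) = norm x"
    using False by (simp add: c_def norm_scaleC norm_divide)
  finally show ?thesis .
qed simp

lemma bounded_linear_cinner_left:
  "bounded_linear (\<lambda>x. cinner x (y :: 'a :: complex_hilbert_space))"
  by (rule bounded_linear_intro[where K = "norm y"])
    (simp_all add: cinner_add_left cinner_scaleR_left cmod_cinner_le scaleR_conv_of_real)

lemma bounded_ops_scaleC:
  "T \<in> bounded_ops \<Longrightarrow> blinfun_apply T (c *\<^sub>C x) = c *\<^sub>C blinfun_apply T x"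
  by (simp add: bounded_ops_def)


section \<open>Finite orthonormal bases\<close>

text \<open>Split off from \<open>is_onb\<close> because the eigenbases below are grown from
  orthonormal sets that are not yet maximal.\<close>

definition orthonormal :: "'a :: complex_hilbert_space set \<Rightarrow> bool"
  where "orthonormal E \<longleftrightarrow> (\<forall>e\<in>E. \<forall>e'\<in>E. cinner e e' = (if e = e' then 1 else 0))"

lemma is_onb_iff: "is_onb E \<longleftrightarrow> orthonormal E \<and> (\<forall>x. (\<forall>e\<in>E. cinner x e = 0) \<longrightarrow> x = 0)"
  by (simp add: is_onb_def orthonormal_def)

lemma orthonormalD:
  assumes "orthonormal E" "e \<in> E" "e' \<in> E"
  shows "cinner e e' = (if e = e' then 1 else 0)"
  using assms by (simp add: orthonormal_def)

lemma orthonormal_norm: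
  assumes "orthonormal E" "e \<in> E"
  shows "norm e = 1"
proof -
  have "complex_of_real ((norm e)\<^sup>2) = complex_of_real 1"
    using orthonormalD[OF assms(1,2,2)] cinner_self[of e] by simp
  then have "(norm e)\<^sup>2 = 1\<^sup>2"
    unfolding of_real_eq_iff by simp
  then show ?thesis
    by (rule power2_eq_imp_eq) auto
qed

lemma orthonormal_coeff:
  assumes "orthonormal E" "finite E" "d \<in> E"
  shows "cinner (\<Sum>e\<in>E. c e *\<^sub>C e) d = c d"
proof -
  have "cinner (\<Sum>e\<in>E. c e *\<^sub>C e) d = (\<Sum>e\<in>E. if e = d then c e else 0)"
    unfolding cinner_sum_left cinner_scaleC_left
    by (intro sum.cong refl) (use assms in \<open>simp add: orthonormalD\<close>)
  then show ?thesis
    using assms by simp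
qed

text \<open>The right side minus the left side is the squared norm of \<open>x - y\<close>, where
  \<open>y\<close> is the orthogonal projection of \<open>x\<close> to the span of
  \<open>E\<close>.\<close>

lemma bessel_inequality:
  assumes "orthonormal E" "finite E"
  shows "(\<Sum>e\<in>E. (cmod (cinner x e))\<^sup>2) \<le> (norm x)\<^sup>2"
proof -
  define y where "y = (\<Sum>e\<in>E. cinner x e *\<^sub>C e)"
  have yx: "cinner y z = (\<Sum>e\<in>E. cinner x e * cnj (cinner z e))" for z
    unfolding y_def cinner_sum_left cinner_scaleC_left
    by (subst cinner_commute[of _ z]) simp
  have "cinner y y = (\<Sum>e\<in>E. cinner x e * cnj (cinner x e))"
    unfolding yx[of y]
    by (intro sum.cong refl) (simp add: y_def orthonormal_coeff[OF assms])
  also have "\<dots> = complex_of_real (\<Sum>e\<in>E. (cmod (cinner x e))\<^sup>2)"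
    by (simp only: of_real_sum complex_norm_square)
  finally have yy: "cinner y y = complex_of_real (\<Sum>e\<in>E. (cmod (cinner x e))\<^sup>2)" .
  have "cinner y x = complex_of_real (\<Sum>e\<in>E. (cmod (cinner x e))\<^sup>2)"
    unfolding yx by (simp only: of_real_sum complex_norm_square)
  moreover have "(norm (x - y))\<^sup>2 = inner x x - 2 * inner y x + inner y y"
    by (simp add: power2_norm_eq_inner inner_diff_left inner_diff_right inner_commute[of x y])
  ultimately have "(norm (x - y))\<^sup>2 = (norm x)\<^sup>2 - (\<Sum>e\<in>E. (cmod (cinner x e))\<^sup>2)"
    using yy by (simp add: inner_eq_Re_cinner[of y] power2_norm_eq_inner[of x] del: of_real_sum)
  then show ?thesis
    using zero_le_power2[of "norm (x - y)"] by linarith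
qed

lemma onb_expansion:
  assumes "is_onb E" "finite E"
  shows "(\<Sum>e\<in>E. cinner x e *\<^sub>C e) = x"
proof -
  have "cinner ((\<Sum>e\<in>E. cinner x e *\<^sub>C e) - x) d = 0" if "d \<in> E" for d
    using assms that by (simp add: cinner_diff_left orthonormal_coeff is_onb_iff)
  then have "(\<Sum>e\<in>E. cinner x e *\<^sub>C e) - x = 0"
    using assms unfolding is_onb_iff by blast
  then show ?thesis by simp
qed

lemma onb_parseval:
  assumes "is_onb E" "finite E"
  shows "cinner x y = (\<Sum>e\<in>E. cinner x e * cnj (cinner y e))"
proof -
  have "cinner x y = cinner (\<Sum>e\<in>E. cinner x e *\<^sub>C e) y"
    by (simp add: onb_expansion assms)
  also have "\<dots> = (\<Sum>e\<in>E. cinner x e * cnj (cinner y e))"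
    unfolding cinner_sum_left cinner_scaleC_left
    by (subst cinner_commute[of _ y]) simp
  finally show ?thesis .
qed

lemma onb_norm_square:
  assumes "is_onb E" "finite E"
  shows "(norm x)\<^sup>2 = (\<Sum>e\<in>E. (cmod (cinner x e))\<^sup>2)"
proof -
  have "complex_of_real ((norm x)\<^sup>2) = complex_of_real (\<Sum>e\<in>E. (cmod (cinner x e))\<^sup>2)"
    using onb_parseval[OF assms, of x x] by (simp only: cinner_self complex_norm_square of_real_sum)
  then show ?thesis
    by (simp only: of_real_eq_iff)
qed

lemma onb_eqI:
  assumes "is_onb E" "\<And>e. e \<in> E \<Longrightarrow> cinner x e = cinner y e"
  shows "x = y"
proof -
  have "\<forall>e\<in>E. cinner (x - y) e = 0"
    using assms(2) by (simp add: cinner_diff_left)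
  then have "x - y = 0"
    using assms(1) unfolding is_onb_iff by blast
  then show ?thesis by simp
qed

lemma cmod_cinner_commute: "cmod (cinner x y) = cmod (cinner y (x :: 'a :: complex_hilbert_space))"
  by (metis cinner_commute complex_mod_cnj)

text \<open>Double counting of the squares of \<open>cmod (cinner f e)\<close> over both sets:
  Parseval in \<open>E\<close> for each \<open>f\<close> gives exactly \<open>card F\<close>, and
  Bessel in \<open>F\<close> for each \<open>e\<close> gives at most \<open>card E\<close>.\<close>

lemma orthonormal_card_le:
  fixes E F :: "'a :: complex_hilbert_space set"
  assumes "is_onb E" "finite E" "orthonormal F" "finite F"
  shows "card F \<le> card E"
proof -
  have "real (card F) = (\<Sum>f\<in>F. (norm f)\<^sup>2)"
    using assms(3) by (simp add: orthonormal_norm)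
  also have "\<dots> = (\<Sum>e\<in>E. \<Sum>f\<in>F. (cmod (cinner f e))\<^sup>2)"
    unfolding onb_norm_square[OF assms(1,2)] by (rule sum.swap)
  also have "\<dots> = (\<Sum>e\<in>E. \<Sum>f\<in>F. (cmod (cinner e f))\<^sup>2)"
    by (simp only: cmod_cinner_commute)
  also have "\<dots> \<le> (\<Sum>e\<in>E. (norm e)\<^sup>2)"
    by (intro sum_mono bessel_inequality assms)
  also have "\<dots> = real (card E)"
    using assms(1) orthonormal_norm[of E] by (simp add: is_onb_iff)
  finally show ?thesis by simp
qed

lemma orthonormal_subset: "orthonormal F \<Longrightarrow> G \<subseteq> F \<Longrightarrow> orthonormal G"
  unfolding orthonormal_def by blast

text \<open>An infinite orthonormal set would contain one with \<open>Suc (card E)\<close> elements,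
  against the cardinality bound.\<close>

lemma orthonormal_finite:
  fixes E F :: "'a :: complex_hilbert_space set"
  assumes "is_onb E" "finite E" "orthonormal F"
  shows "finite F"
proof (rule ccontr)
  assume "infinite F"
  then obtain G where G: "G \<subseteq> F" "finite G" "card G = Suc (card E)"
    using infinite_arbitrarily_large by blast
  then have "orthonormal G"
    using assms(3) orthonormal_subset by blast
  with G assms show False
    using orthonormal_card_le[of E G] by simp
qed

section \<open>Compactness of the unit sphere\<close>

lemma compact_bounded_combinations:
  fixes E :: "'a :: complex_hilbert_space set"
  assumes "finite E"
  shows "compact {(\<Sum>e\<in>E. c e *\<^sub>C e) | c. \<forall>e\<in>E. cmod (c e) \<le> 1}"
  using assms
proof (induction E)
  case (insert a E)
  let ?K = "\<lambda>E :: 'a set. {(\<Sum>e\<in>E. c e *\<^sub>C e) | c. \<forall>e\<in>E. cmod (c e) \<le> 1}"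
  have lin: "bounded_linear (\<lambda>z :: complex. z *\<^sub>C a)"
    by (rule bounded_linear_intro[where K = "norm a"])
      (simp_all add: scaleC_add_left scaleR_scaleC scaleC_scaleC norm_scaleC scaleR_conv_of_real)
  \<comment> \<open>The set for \<open>insert a E\<close> is the image under this map of the closed
    unit disc times the set for \<open>E\<close>; the disc carries the coefficient of
    \<open>a\<close>.\<close>
  then have "continuous_on (cball 0 1 \<times> ?K E) (\<lambda>q. fst q *\<^sub>C a + snd q)"
    by (intro continuous_on_add bounded_linear.continuous_on[OF lin] continuous_on_fst
        continuous_on_snd continuous_on_id)
  then have "compact ((\<lambda>q. fst q *\<^sub>C a + snd q) ` (cball 0 1 \<times> ?K E))"
    by (intro compact_continuous_image compact_Times insert.IH compact_cball)
  also have "(\<lambda>q. fst q *\<^sub>C a + snd q) ` (cball 0 1 \<times> ?K E) = ?K (insert a E)"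
  proof (intro equalityI subsetI)
    fix x assume "x \<in> (\<lambda>q. fst q *\<^sub>C a + snd q) ` (cball 0 1 \<times> ?K E)"
    then obtain z c where x: "x = z *\<^sub>C a + (\<Sum>e\<in>E. c e *\<^sub>C e)"
      and zc: "cmod z \<le> 1" "\<forall>e\<in>E. cmod (c e) \<le> 1"
      by auto
    have "(\<Sum>e\<in>E. (c(a := z)) e *\<^sub>C e) = (\<Sum>e\<in>E. c e *\<^sub>C e)"
      by (intro sum.cong) (use insert.hyps in auto)
    then have "x = (\<Sum>e\<in>insert a E. (c(a := z)) e *\<^sub>C e)"
      using insert.hyps x by simp
    moreover have "\<forall>e\<in>insert a E. cmod ((c(a := z)) e) \<le> 1"
      using zc by simp
    ultimately show "x \<in> ?K (insert a E)" by blast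
  next
    fix x assume "x \<in> ?K (insert a E)"
    then obtain c where x: "x = (\<Sum>e\<in>insert a E. c e *\<^sub>C e)"
      and c: "\<forall>e\<in>insert a E. cmod (c e) \<le> 1"
      by auto
    show "x \<in> (\<lambda>q. fst q *\<^sub>C a + snd q) ` (cball 0 1 \<times> ?K E)"
      by (rule image_eqI[where x = "(c a, \<Sum>e\<in>E. c e *\<^sub>C e)"])
        (use insert.hyps x c in auto)
  qed
  finally show ?case .
qed simp

text \<open>The coefficients of a unit vector have modulus at most 1, so the sphere is a closed part
  of the compact set of bounded combinations. Finite dimension enters only through the basis
  \<open>E\<close>, since the type itself does not record it.\<close>

lemma compact_sphere_onb:
  fixes E :: "'a :: complex_hilbert_space set"
  assumes "is_onb E" "finite E"
  shows "compact {x :: 'a. norm x = 1}"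
proof -
  let ?K = "{(\<Sum>e\<in>E. c e *\<^sub>C e) | c. \<forall>e\<in>E. cmod (c e) \<le> 1}"
  have "{x :: 'a. norm x = 1} \<subseteq> ?K"
  proof
    fix x :: 'a assume "x \<in> {x. norm x = 1}"
    then have "cmod (cinner x e) \<le> 1" if "e \<in> E" for e
      using cmod_cinner_le[of x e] orthonormal_norm[of E e] that assms(1)
      by (simp add: is_onb_iff)
    then show "x \<in> ?K"
      using onb_expansion[OF assms, of x, symmetric] by blast
  qed
  moreover have "closed {x :: 'a. norm x = 1}"
    by (intro closed_Collect_eq continuous_intros)
  ultimately show ?thesis
    using compact_Int_closed[OF compact_bounded_combinations[OF assms(2)], of "{x. norm x = 1}"]
    by (simp only: Int_absorb1)
qed


section \<open>Positive operators in finite dimension\<close>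

text \<open>Polarization: since the quadratic form is real, its value at \<open>x + y\<close> shows
  that \<open>a\<close> and \<open>b\<close> have opposite imaginary parts, and its value at
  \<open>x + \<i> *\<^sub>C y\<close> that they have equal real parts.\<close>

lemma positive_op_selfadjoint:
  assumes "positive_op T"
  shows "cinner (blinfun_apply T x) y = cinner x (blinfun_apply T y)"
proof -
  have T: "T \<in> bounded_ops" and pos: "\<And>x. Im (cinner (blinfun_apply T x) x) = 0"
    using assms by (auto simp: positive_op_def less_eq_complex_def)
  define a b where "a = cinner (blinfun_apply T x) y" and "b = cinner (blinfun_apply T y) x"
  have "Im (a + b) = 0"
    using pos[of "x + y"] pos[of x] pos[of y]
    by (simp add: blinfun.add_right cinner_add_left cinner_add_right a_def b_def)
  moreover have "Re b - Re a = 0"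
    using pos[of "x + \<i> *\<^sub>C y"] pos[of x] pos[of y]
    by (simp add: blinfun.add_right cinner_add_left cinner_add_right a_def b_def
        bounded_ops_scaleC[OF T] cinner_scaleC_left cinner_scaleC_right)
  ultimately have "a = cnj b"
    by (simp add: complex_eq_iff)
  then show ?thesis
    unfolding a_def b_def by (metis cinner_commute)
qed

lemma positive_op_inner_nonneg:
  "positive_op T \<Longrightarrow> 0 \<le> inner (blinfun_apply T x) x"
  by (simp add: positive_op_def less_eq_complex_def inner_eq_Re_cinner)

text \<open>A maximizer of \<open>\<langle>T x, x\<rangle>\<close> on the unit sphere of the orthogonal complement of \<open>F\<close>.\<close>

lemma selfadjoint_eigenvector:
  fixes T :: "'a :: complex_hilbert_space \<Rightarrow>\<^sub>L 'a" and E :: "'a set"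
  assumes E: "is_onb E" "finite E"
    and sym: "\<And>x y. cinner (blinfun_apply T x) y = cinner x (blinfun_apply T y)"
    and F: "\<And>f. f \<in> F \<Longrightarrow> \<exists>r :: real. blinfun_apply T f = r *\<^sub>R f"
    and x0: "x0 \<noteq> 0" "\<forall>f\<in>F. cinner x0 f = 0"
  shows "\<exists>x r. norm x = 1 \<and> (\<forall>f\<in>F. cinner x f = 0) \<and> blinfun_apply T x = r *\<^sub>R x"
proof -
  define W where "W = {x. \<forall>f\<in>F. cinner x f = 0}"
  define S where "S = {x. norm x = 1} \<inter> W"
  have "W = (\<Inter>f\<in>F. {x. cinner x f = 0})"
    by (auto simp: W_def)
  moreover have "closed {x. cinner x f = 0}" for f :: 'a
    by (intro closed_Collect_eq continuous_intros linear_continuous_on bounded_linear_cinner_left)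
  ultimately have "closed W"
    by auto
  with compact_sphere_onb[OF E] have "compact S"
    unfolding S_def by (rule compact_Int_closed)
  have W_scale: "r *\<^sub>R x \<in> W" if "x \<in> W" for r x
    using that by (simp add: W_def cinner_scaleR_left)
  have "(1 / norm x0) *\<^sub>R x0 \<in> S"
    unfolding S_def using x0 W_scale[of x0] by (simp add: W_def)
  then have "S \<noteq> {}" by blast
  have "continuous_on S (\<lambda>x. inner (blinfun_apply T x) x)"
    by (intro continuous_intros)
  then obtain x where x: "x \<in> S"
    and max: "\<And>y. y \<in> S \<Longrightarrow> inner (blinfun_apply T y) y \<le> inner (blinfun_apply T x) x"
    using continuous_attains_sup[OF \<open>compact S\<close> \<open>S \<noteq> {}\<close>] by blast
  define r where "r = inner (blinfun_apply T x) x"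
  define b where "b = r *\<^sub>R x - blinfun_apply T x"
  have xW: "x \<in> W" and nx: "norm x = 1" using x by (auto simp: S_def)
  \<comment> \<open>Homogeneity carries the maximum from the unit sphere to the whole subspace
    \<open>W\<close>.\<close>
  have bound: "inner (blinfun_apply T w) w \<le> r * inner w w" if "w \<in> W" for w
  proof (cases "w = 0")
    case False
    then have "(1 / norm w) *\<^sub>R w \<in> S"
      using W_scale[OF that] by (simp add: S_def)
    from max[OF this] False show ?thesis
      by (simp add: r_def blinfun.scaleR_right field_simps power2_norm_eq_inner[symmetric]
          power2_eq_square)
  qed simp
  \<comment> \<open>\<open>W\<close> is invariant at \<open>x\<close> because \<open>F\<close>
    consists of eigenvectors with real eigenvalues and \<open>T\<close> is symmetric.\<close>
  have TW: "blinfun_apply T x \<in> W"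
    unfolding W_def
  proof safe
    fix f assume f: "f \<in> F"
    then obtain s where s: "blinfun_apply T f = s *\<^sub>R f" using F by blast
    show "cinner (blinfun_apply T x) f = 0"
      using xW f unfolding sym s by (simp add: W_def scaleR_scaleC cinner_scaleC_right)
  qed
  have bW: "b \<in> W"
    using xW TW by (simp add: b_def W_def cinner_diff_left cinner_scaleR_left)
  have isym: "inner (blinfun_apply T x) y = inner x (blinfun_apply T y)" for x y
    by (simp add: inner_eq_Re_cinner sym)
  have isymb: "inner (blinfun_apply T b) x = inner (blinfun_apply T x) b"
    by (simp add: isym[of x b] inner_commute[of _ x])
  define k where "k = r * inner b b - inner (blinfun_apply T b) b"
  \<comment> \<open>First variation: the bound is evaluated at the maximizer \<open>x\<close> moved
    by \<open>t\<close> in the direction of the residual \<open>b\<close>. The linear term in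
    \<open>t\<close> has coefficient \<open>2 * inner b b\<close>, and an expression of this shape
    is nonnegative for all \<open>t\<close> only if that coefficient vanishes.\<close>
  have quad: "0 \<le> 2 * t * inner b b + t\<^sup>2 * k" for t
  proof -
    have "x + t *\<^sub>R b \<in> W"
      using xW bW by (simp add: W_def cinner_add_left cinner_scaleR_left)
    note le = bound[OF this]
    have sq: "inner (x + t *\<^sub>R b) (x + t *\<^sub>R b) = 1 + 2 * t * inner x b + t\<^sup>2 * inner b b"
      using nx by (simp add: inner_add_left inner_add_right inner_commute[of b x] power2_eq_square
          distrib_left norm_eq_1)
    have "inner (blinfun_apply T (x + t *\<^sub>R b)) (x + t *\<^sub>R b)
      = r + 2 * t * inner (blinfun_apply T x) b + t\<^sup>2 * inner (blinfun_apply T b) b"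
      by (simp add: blinfun.add_right blinfun.scaleR_right inner_add_left inner_add_right
          isymb power2_eq_square distrib_left r_def)
    with le have "0 \<le> 2 * t * (r * inner x b - inner (blinfun_apply T x) b) + t\<^sup>2 * k"
      unfolding sq k_def by (simp add: algebra_simps)
    also have "r * inner x b - inner (blinfun_apply T x) b = inner b b"
      by (subst (3) b_def) (simp add: inner_diff_left)
    finally show ?thesis .
  qed
  have "inner b b = 0"
  proof (rule ccontr)
    assume "inner b b \<noteq> 0"
    then have pos: "inner b b > 0" by simp
    \<comment> \<open>This \<open>t\<close> is small enough that
      \<open>t * k \<le> inner b b\<close>, so the linear term dominates at \<open>- t\<close>. The
      \<open>+ 1\<close> avoids division by zero when \<open>k = 0\<close>.\<close>
    define t where "t = inner b b / (\<bar>k\<bar> + 1)"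
    have t: "t > 0" using pos by (simp add: t_def)
    have "t * k \<le> t * (\<bar>k\<bar> + 1)"
      using t by (intro mult_left_mono) auto
    also have "\<dots> = inner b b"
      by (simp add: t_def)
    finally have "t * k - 2 * inner b b < 0"
      using pos by linarith
    with t have "t * (t * k - 2 * inner b b) < 0"
      by (rule mult_pos_neg)
    then show False
      using quad[of "- t"] by (simp add: algebra_simps power2_eq_square)
  qed
  then have "blinfun_apply T x = r *\<^sub>R x" by (simp add: b_def)
  then show ?thesis using nx xW by (auto simp: W_def)
qed

text \<open>Orthonormal sets of eigenvectors have at most \<open>card E\<close> elements, so one of
  largest cardinality exists. If it were not a basis, the preceding lemma would supply one more
  eigenvector orthogonal to it.\<close>

lemma selfadjoint_eigenbasis:
  fixes T :: "'a :: complex_hilbert_space \<Rightarrow>\<^sub>L 'a" and E :: "'a set"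
  assumes E: "is_onb E" "finite E"
    and sym: "\<And>x y. cinner (blinfun_apply T x) y = cinner x (blinfun_apply T y)"
  shows "\<exists>F. is_onb F \<and> finite F \<and> (\<forall>f\<in>F. \<exists>r :: real. blinfun_apply T f = r *\<^sub>R f)"
proof -
  define eig where
    "eig F \<longleftrightarrow> orthonormal F \<and> (\<forall>f\<in>F. \<exists>r :: real. blinfun_apply T f = r *\<^sub>R f)" for F
  have fin: "finite F" if "eig F" for F
    using that orthonormal_finite[OF E] by (simp add: eig_def)
  have "eig {}"
    by (simp add: eig_def orthonormal_def)
  moreover have "\<forall>F. eig F \<longrightarrow> card F < Suc (card E)"
    using orthonormal_card_le[OF E] fin by (simp add: eig_def less_Suc_eq_le)
  ultimately have "\<exists>F. eig F \<and> (\<forall>G. eig G \<longrightarrow> card G \<le> card F)"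
    by (rule ex_has_greatest_nat)
  then obtain F where F: "eig F" and max: "\<And>G. eig G \<Longrightarrow> card G \<le> card F"
    by blast
  have "is_onb F"
  proof (rule ccontr)
    assume "\<not> is_onb F"
    then obtain x0 where "x0 \<noteq> 0" "\<forall>f\<in>F. cinner x0 f = 0"
      using F by (auto simp: is_onb_iff eig_def)
    then obtain x r where x: "norm x = 1" "\<forall>f\<in>F. cinner x f = 0" "blinfun_apply T x = r *\<^sub>R x"
      using selfadjoint_eigenvector[OF E sym, of F x0] F unfolding eig_def by blast
    have xx: "cinner x x = 1"
      using x(1) by (simp add: cinner_self)
    have "cinner f x = 0" if "f \<in> F" for f
      using x(2) that by (subst cinner_commute) simp
    then have "orthonormal (insert x F)"
      using F x(2) xx unfolding eig_def orthonormal_def by auto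
    then have "eig (insert x F)"
      using F x(3) by (auto simp: eig_def)
    from max[OF this] have "x \<in> F"
      using fin[OF F] by (auto simp: card_insert_if split: if_splits)
    then show False
      using x(2) xx by auto
  qed
  then show ?thesis
    using F fin by (auto simp: eig_def)
qed

text \<open>Evaluating the form at \<open>x - t T x\<close> with \<open>t = 1 / (\<parallel>T\<parallel> + 1)\<close> gives
  \<open>t \<parallel>T x\<parallel>\<^sup>2 \<le> \<langle>T x, x\<rangle>\<close>.\<close>

lemma positive_invertible_bounded_below:
  assumes T: "positive_op T" and S: "is_inverse_op T S"
  shows "\<exists>c>0. \<forall>x. c * (norm x)\<^sup>2 \<le> inner (blinfun_apply T x) x"
proof -
  define t where "t = 1 / (norm T + 1)"
  have t: "t > 0" and tT: "t * norm T \<le> 1"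
    by (simp_all add: t_def field_simps add_pos_nonneg)
  have ST: "blinfun_apply S (blinfun_apply T x) = x" for x
    using S by (metis is_inverse_op_def blinfun_apply_blinfun_compose blinfun_apply_id_blinfun id_apply)
  have isym: "inner (blinfun_apply T x) y = inner x (blinfun_apply T y)" for x y
    by (simp add: inner_eq_Re_cinner positive_op_selfadjoint[OF T])
  have low: "t * (norm (blinfun_apply T x))\<^sup>2 \<le> inner (blinfun_apply T x) x" for x
  proof -
    let ?y = "blinfun_apply T x"
    have "0 \<le> inner (blinfun_apply T (x - t *\<^sub>R ?y)) (x - t *\<^sub>R ?y)"
      by (rule positive_op_inner_nonneg[OF T])
    also have "\<dots> = inner ?y x - 2 * t * (norm ?y)\<^sup>2 + t * (t * inner (blinfun_apply T ?y) ?y)"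
      using isym[of ?y x]
      by (simp add: blinfun.diff_right blinfun.scaleR_right inner_diff_left inner_diff_right
          power2_norm_eq_inner algebra_simps)
    finally have *: "0 \<le> inner ?y x - 2 * t * (norm ?y)\<^sup>2
      + t * (t * inner (blinfun_apply T ?y) ?y)" .
    have "inner (blinfun_apply T ?y) ?y \<le> norm T * norm ?y * norm ?y"
      by (rule order_trans[OF norm_cauchy_schwarz]) (intro mult_right_mono norm_blinfun norm_ge_zero)
    then have "t * inner (blinfun_apply T ?y) ?y \<le> t * (norm T * norm ?y * norm ?y)"
      using t by (intro mult_left_mono) auto
    also have "\<dots> = (t * norm T) * (norm ?y)\<^sup>2"
      by (simp add: power2_eq_square)
    also have "\<dots> \<le> 1 * (norm ?y)\<^sup>2"
      using tT by (intro mult_right_mono) auto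
    finally have "t * (t * inner (blinfun_apply T ?y) ?y) \<le> t * (norm ?y)\<^sup>2"
      using t by (intro mult_left_mono) auto
    with * show ?thesis by linarith
  qed
  \<comment> \<open>The inverse turns the lower bound in terms of \<open>T x\<close> into one in
    terms of \<open>x\<close>, through \<open>norm x \<le> norm S * norm (T x)\<close>. The
    \<open>+ 1\<close> keeps the denominator positive.\<close>
  define c where "c = t / (norm S + 1)\<^sup>2"
  have S1: "(norm S + 1)\<^sup>2 > 0"
    by (intro zero_less_power add_nonneg_pos) auto
  have "c * (norm x)\<^sup>2 \<le> inner (blinfun_apply T x) x" for x
  proof -
    have "norm x \<le> norm S * norm (blinfun_apply T x)"
      using norm_blinfun[of S "blinfun_apply T x"] by (simp add: ST)
    also have "\<dots> \<le> (norm S + 1) * norm (blinfun_apply T x)"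
      by (intro mult_right_mono) auto
    finally have "(norm x)\<^sup>2 \<le> ((norm S + 1) * norm (blinfun_apply T x))\<^sup>2"
      by (intro power_mono) auto
    then have "c * (norm x)\<^sup>2 \<le> c * ((norm S + 1)\<^sup>2 * (norm (blinfun_apply T x))\<^sup>2)"
      using t S1 unfolding c_def power_mult_distrib by (intro mult_left_mono) auto
    also have "\<dots> = t * (norm (blinfun_apply T x))\<^sup>2"
      using S1 by (simp add: c_def)
    finally show ?thesis
      using low[of x] by linarith
  qed
  moreover have "c > 0"
    unfolding c_def using t S1 by (rule divide_pos_pos)
  ultimately show ?thesis by blast
qed

text \<open>The diagonal entries of \<open>P\<close> are summable and bounded away from \<open>0\<close>.\<close>

lemma invertible_density_finite_onb:
  fixes P :: "'a :: complex_hilbert_space \<Rightarrow>\<^sub>L 'a"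
  assumes P: "P \<in> density_ops" "invertible_op P"
  shows "\<exists>E :: 'a set. is_onb E \<and> finite E"
proof -
  \<comment> \<open>This is the very basis that \<open>tr\<close> selects, so
    \<open>tr P = 1\<close> becomes a statement about the sum over \<open>E\<close>.\<close>
  define E :: "'a set" where "E = (SOME E. is_onb E)"
  have "\<exists>E :: 'a set. is_onb E"
    using P by (auto simp: density_ops_def trace_class_def)
  then have E: "is_onb E"
    unfolding E_def by (rule someI_ex)
  have pos: "positive_op P" and "tr P = 1"
    using P by (auto simp: density_ops_def)
  then have "infsum (\<lambda>e. cinner (blinfun_apply P e) e) E = 1"
    by (simp add: tr_def E_def)
  \<comment> \<open>\<open>infsum\<close> takes the value 0 on families that are not summable, so
    the value 1 already proves summability.\<close>
  then have "(\<lambda>e. cinner (blinfun_apply P e) e) summable_on E"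
    using infsum_not_exists by fastforce
  then have summ: "(\<lambda>e. inner (blinfun_apply P e) e) summable_on E"
    using summable_on_bounded_linear[OF bounded_linear_Re] by (simp add: inner_eq_Re_cinner)
  obtain c where c: "c > 0" "\<And>x. c * (norm x)\<^sup>2 \<le> inner (blinfun_apply P x) x"
    using positive_invertible_bounded_below[OF pos] P(2) unfolding invertible_op_def by blast
  define b where "b = infsum (\<lambda>e. inner (blinfun_apply P e) e) E"
  have card: "real (card G) \<le> b / c" if G: "G \<subseteq> E" "finite G" for G
  proof -
    have "c * real (card G) = (\<Sum>e\<in>G. c * (norm e)\<^sup>2)"
      using G E orthonormal_norm[of E] by (simp add: is_onb_iff subset_iff)
    also have "\<dots> \<le> (\<Sum>e\<in>G. inner (blinfun_apply P e) e)"
      by (intro sum_mono c)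
    also have "\<dots> \<le> b"
      unfolding b_def using G
      by (intro finite_sum_le_infsum summ positive_op_inner_nonneg pos) auto
    finally show ?thesis
      using c(1) by (simp add: field_simps)
  qed
  have "finite E"
  proof (rule ccontr)
    assume "infinite E"
    \<comment> \<open>The size is chosen to exceed \<open>b / c\<close>, the bound on all finite
      parts of \<open>E\<close>.\<close>
    then obtain G where "G \<subseteq> E" "finite G" "card G = Suc (nat \<lceil>b / c\<rceil>)"
      using infinite_arbitrarily_large by blast
    with card[of G] show False
      by linarith
  qed
  with E show ?thesis by blast
qed

section \<open>Adjoints, traces and Hilbert-Schmidt products in a finite basis\<close>

lemma bounded_ops_onb_expansion:
  fixes E :: "'a :: complex_hilbert_space set" and T :: "'a \<Rightarrow>\<^sub>L 'a"
  assumes "is_onb E" "finite E" "T \<in> bounded_ops"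
  shows "blinfun_apply T x = (\<Sum>e\<in>E. cinner x e *\<^sub>C blinfun_apply T e)"
proof -
  have "blinfun_apply T x = blinfun_apply T (\<Sum>e\<in>E. cinner x e *\<^sub>C e)"
    by (simp add: onb_expansion assms)
  then show ?thesis
    by (simp add: blinfun.sum_right bounded_ops_scaleC assms)
qed

lemma bounded_ops_eqI:
  fixes E :: "'a :: complex_hilbert_space set" and T :: "'a \<Rightarrow>\<^sub>L 'a"
  assumes "is_onb E" "finite E" "T \<in> bounded_ops" "S \<in> bounded_ops"
    and "\<And>e. e \<in> E \<Longrightarrow> blinfun_apply T e = blinfun_apply S e"
  shows "T = S"
proof (rule blinfun_eqI)
  fix x
  show "blinfun_apply T x = blinfun_apply S x"
    unfolding bounded_ops_onb_expansion[OF assms(1,2,3), of x]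
      bounded_ops_onb_expansion[OF assms(1,2,4), of x]
    by (simp add: assms(5))
qed

lemma bounded_ops_zero [simp]: "0 \<in> bounded_ops"
  by (simp add: bounded_ops_def)

lemma bounded_ops_id [simp]: "id_blinfun \<in> bounded_ops"
  by (simp add: bounded_ops_def)

lemma bounded_ops_add: "S \<in> bounded_ops \<Longrightarrow> T \<in> bounded_ops \<Longrightarrow> S + T \<in> bounded_ops"
  by (simp add: bounded_ops_def blinfun.add_left scaleC_add_right)

lemma bounded_ops_scale: "T \<in> bounded_ops \<Longrightarrow> c *\<^sub>C T \<in> bounded_ops"
  by (simp add: bounded_ops_def scaleC_blinfun.rep_eq scaleC_scaleC mult.commute)

lemma bounded_ops_sum: "(\<And>i. i \<in> I \<Longrightarrow> X i \<in> bounded_ops) \<Longrightarrow> (\<Sum>i\<in>I. X i) \<in> bounded_ops"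
  by (induction I rule: infinite_finite_induct) (simp_all add: bounded_ops_add)

lemma bounded_ops_compose: "S \<in> bounded_ops \<Longrightarrow> T \<in> bounded_ops \<Longrightarrow> S o\<^sub>L T \<in> bounded_ops"
  by (simp add: bounded_ops_def)

text \<open>These operators build the adjoint and the square root below; with \<open>u\<close> and
  \<open>v\<close> from two bases they are the matrix units of the Hilbert-Schmidt space.\<close>

lift_definition rank_one :: "'a :: complex_hilbert_space \<Rightarrow> 'a \<Rightarrow> ('a \<Rightarrow>\<^sub>L 'a)"
  is "\<lambda>u v x. cinner x v *\<^sub>C u"
proof -
  fix u v :: 'a
  show "bounded_linear (\<lambda>x. cinner x v *\<^sub>C u)"
  proof (rule bounded_linear_intro[where K = "norm v * norm u"])
    fix x
    show "norm (cinner x v *\<^sub>C u) \<le> norm x * (norm v * norm u)"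
      using mult_right_mono[OF cmod_cinner_le[of x v] norm_ge_zero[of u]]
      by (simp add: norm_scaleC mult.assoc)
  qed (simp_all add: cinner_add_left scaleC_add_left cinner_scaleC_left scaleR_scaleC scaleC_scaleC)
qed

lemma rank_one_in_bounded_ops [simp]: "rank_one u v \<in> bounded_ops"
  by (simp add: bounded_ops_def rank_one.rep_eq cinner_scaleC_left scaleC_scaleC)

text \<open>\<open>adj\<close> is a definite description, so an adjoint has to be exhibited and
  shown to be unique. The witness \<open>S\<close> sends \<open>y\<close> to the vector with
  coefficients \<open>cinner y (T e)\<close>; uniqueness holds because a vector is determined by its
  inner products.\<close>

lemma cinner_adj:
  fixes E :: "'a :: complex_hilbert_space set" and T :: "'a \<Rightarrow>\<^sub>L 'a"
  assumes E: "is_onb E" "finite E" and T: "T \<in> bounded_ops"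
  shows "cinner x (blinfun_apply (adj T) y) = cinner (blinfun_apply T x) y"
proof -
  define S where "S = (\<Sum>e\<in>E. rank_one e (blinfun_apply T e))"
  have S: "cinner (blinfun_apply T x) y = cinner x (blinfun_apply S y)" for x y
  proof -
    have "cinner (blinfun_apply S y) x = (\<Sum>e\<in>E. cinner y (blinfun_apply T e) * cinner e x)"
      by (simp add: S_def blinfun.sum_left rank_one.rep_eq cinner_sum_left cinner_scaleC_left)
    then have "cnj (cinner (blinfun_apply S y) x) =
      (\<Sum>e\<in>E. cnj (cinner e x) * cnj (cinner y (blinfun_apply T e)))"
      by (simp add: mult.commute)
    also have "\<dots> = (\<Sum>e\<in>E. cinner x e * cinner (blinfun_apply T e) y)"
      by (simp only: cinner_commute[symmetric])
    also have "\<dots> = cinner (blinfun_apply T x) y"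
      unfolding bounded_ops_onb_expansion[OF E T, of x] cinner_sum_left cinner_scaleC_left ..
    finally show ?thesis
      by (simp only: cinner_commute[symmetric])
  qed
  have "adj T = S"
    unfolding adj_def
  proof (rule the_equality)
    fix R assume R: "\<forall>x y. cinner (blinfun_apply T x) y = cinner x (blinfun_apply R y)"
    show "R = S"
    proof (intro blinfun_eqI cinner_eqI)
      fix y z
      have "cinner z (blinfun_apply R y) = cinner z (blinfun_apply S y)"
        using R S by simp
      then show "cinner (blinfun_apply R y) z = cinner (blinfun_apply S y) z"
        by (metis cinner_commute)
    qed
  qed (use S in blast)
  then show ?thesis
    using S by simp
qed

text \<open>Parseval in \<open>F\<close>, an exchange of sums, and Parseval in \<open>E\<close>.
  Since \<open>E\<close> does not occur on the right side, the left side is the same for every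
  finite orthonormal basis.\<close>

lemma sum_onb_cinner_adj:
  fixes E F :: "'a :: complex_hilbert_space set"
  assumes E: "is_onb E" "finite E" and F: "is_onb F" "finite F"
    and UV: "U \<in> bounded_ops" "V \<in> bounded_ops"
  shows "(\<Sum>e\<in>E. cinner (blinfun_apply U e) (blinfun_apply V e))
    = (\<Sum>f\<in>F. cinner (blinfun_apply (adj V) f) (blinfun_apply (adj U) f))"
proof -
  have "(\<Sum>e\<in>E. cinner (blinfun_apply U e) (blinfun_apply V e))
    = (\<Sum>e\<in>E. \<Sum>f\<in>F. cinner (blinfun_apply U e) f * cnj (cinner (blinfun_apply V e) f))"
    by (intro sum.cong refl onb_parseval[OF F])
  also have "\<dots> = (\<Sum>f\<in>F. \<Sum>e\<in>E. cinner (blinfun_apply U e) f * cnj (cinner (blinfun_apply V e) f))"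
    by (rule sum.swap)
  also have "\<dots> = (\<Sum>f\<in>F. cinner (blinfun_apply (adj V) f) (blinfun_apply (adj U) f))"
  proof (intro sum.cong refl)
    fix f
    have "cnj (cinner (blinfun_apply V e) f) = cinner (blinfun_apply (adj V) f) e" for e
      unfolding cinner_adj[OF E UV(2), symmetric] by (metis cinner_commute)
    moreover have "cinner (blinfun_apply U e) f = cnj (cinner (blinfun_apply (adj U) f) e)" for e
      unfolding cinner_adj[OF E UV(1), symmetric] by (metis cinner_commute)
    ultimately show "(\<Sum>e\<in>E. cinner (blinfun_apply U e) f * cnj (cinner (blinfun_apply V e) f))
      = cinner (blinfun_apply (adj V) f) (blinfun_apply (adj U) f)"
      by (simp add: onb_parseval[OF E, of "blinfun_apply (adj V) f" "blinfun_apply (adj U) f"]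
          mult.commute)
  qed
  finally show ?thesis .
qed

lemma hs_inner_onb:
  fixes E :: "'a :: complex_hilbert_space set"
  assumes E: "is_onb E" "finite E" and UV: "U \<in> bounded_ops" "V \<in> bounded_ops"
  shows "hs_inner U V = (\<Sum>e\<in>E. cinner (blinfun_apply U e) (blinfun_apply V e))"
proof -
  define D :: "'a set" where "D = (SOME E. is_onb E)"
  have D: "is_onb D"
    unfolding D_def using E(1) by (rule someI)
  \<comment> \<open>The basis selected by \<open>tr\<close> is finite as well, so its infinite sum
    is an ordinary one.\<close>
  then have D': "finite D"
    using orthonormal_finite[OF E] by (simp add: is_onb_iff)
  have "cinner (blinfun_apply (adj V) (blinfun_apply U e)) e
    = cinner (blinfun_apply U e) (blinfun_apply V e)" for e
    using cinner_adj[OF E UV(2), of e "blinfun_apply U e"] by (metis cinner_commute)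
  then have "hs_inner U V = (\<Sum>e\<in>D. cinner (blinfun_apply U e) (blinfun_apply V e))"
    using D' by (simp add: hs_inner_def tr_def flip: D_def)
  also have "\<dots> = (\<Sum>e\<in>E. cinner (blinfun_apply U e) (blinfun_apply V e))"
    unfolding sum_onb_cinner_adj[OF D D' E UV] sum_onb_cinner_adj[OF E E UV] ..
  finally show ?thesis .
qed

text \<open>The case \<open>V = id_blinfun\<close> of \<open>hs_inner_onb\<close>, as the identity
  is its own adjoint.\<close>

lemma tr_onb:
  fixes E :: "'a :: complex_hilbert_space set"
  assumes E: "is_onb E" "finite E" and T: "T \<in> bounded_ops"
  shows "tr T = (\<Sum>e\<in>E. cinner (blinfun_apply T e) e)"
proof -
  have "adj id_blinfun = (id_blinfun :: 'a \<Rightarrow>\<^sub>L 'a)"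
  proof (intro blinfun_eqI cinner_eqI)
    fix y z :: 'a
    have "cinner z (blinfun_apply (adj id_blinfun) y) = cinner z y"
      by (simp add: cinner_adj[OF E])
    then show "cinner (blinfun_apply (adj id_blinfun) y) z = cinner (blinfun_apply id_blinfun y) z"
      by (metis cinner_commute blinfun_apply_id_blinfun id_apply)
  qed
  moreover have "id_blinfun o\<^sub>L T = T"
    by (rule blinfun_eqI) simp
  ultimately show ?thesis
    using hs_inner_onb[OF E T bounded_ops_id] by (simp add: hs_inner_def)
qed

lemma hs_norm_onb:
  fixes E :: "'a :: complex_hilbert_space set" and T :: "'a \<Rightarrow>\<^sub>L 'a"
  assumes "is_onb E" "finite E" "T \<in> bounded_ops"
  shows "hs_norm T = sqrt (\<Sum>e\<in>E. (norm (blinfun_apply T e))\<^sup>2)"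
  by (simp add: hs_norm_def hs_inner_onb[OF assms(1,2,3,3)] cinner_self)

lemma hilbert_schmidt_eq_bounded_ops:
  fixes E :: "'a :: complex_hilbert_space set"
  assumes "is_onb E" "finite E"
  shows "(hilbert_schmidt :: ('a \<Rightarrow>\<^sub>L 'a) set) = bounded_ops"
  using assms by (auto simp: hilbert_schmidt_def intro!: exI[of _ E])


section \<open>The Araki transform in eigenbases\<close>

text \<open>A multiple of \<open>w\<close>, which vanishes on \<open>S\<close> but not at
  \<open>a\<close>, corrects the value at the new point. As the Araki transform will have finite
  spectrum, exact interpolation takes the place of Weierstrass approximation.\<close>

lemma polynomial_interpolation:
  fixes g :: "'a :: field \<Rightarrow> 'a"
  assumes "finite S"
  shows "\<exists>r. \<forall>x\<in>S. poly r x = g x"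
  using assms
proof (induction S)
  case (insert a S)
  then obtain r where r: "\<forall>x\<in>S. poly r x = g x" by blast
  define w where "w = (\<Prod>s\<in>S. [:- s, 1:])"
  have w: "poly w x = (\<Prod>s\<in>S. x - s)" for x
    by (simp add: w_def poly_prod)
  have "poly w a \<noteq> 0"
    using insert.hyps by (simp add: w)
  moreover have "poly w x = 0" if "x \<in> S" for x
    using insert.hyps that by (auto simp: w)
  ultimately have "\<forall>x\<in>insert a S. poly (r + smult ((g a - poly r a) / poly w a) w) x = g x"
    using r by simp
  then show ?case by blast
qed simp

lemma bounded_ops_on_zero:
  assumes "B \<in> bounded_ops_on V N" "x \<in> V"
  shows "B 0 = 0"
proof -
  have "B (0 *\<^sub>C x) = 0 *\<^sub>C B x"
    using assms unfolding bounded_ops_on_def by blast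
  then show ?thesis by simp
qed

lemma bounded_ops_on_sum:
  assumes B: "B \<in> bounded_ops_on bounded_ops N"
    and X: "\<And>i. i \<in> I \<Longrightarrow> X i \<in> bounded_ops"
  shows "B (\<Sum>i\<in>I. c i *\<^sub>C X i) = (\<Sum>i\<in>I. c i *\<^sub>C B (X i))"
proof -
  have add: "B (x + y) = B x + B y" if "x \<in> bounded_ops" "y \<in> bounded_ops" for x y
    using that B unfolding bounded_ops_on_def by blast
  have scale: "B (d *\<^sub>C x) = d *\<^sub>C B x" if "x \<in> bounded_ops" for x d
    using that B unfolding bounded_ops_on_def by blast
  show ?thesis
    using X
  proof (induction I rule: infinite_finite_induct)
    case (insert j I)
    then show ?case
      by (simp add: add scale bounded_ops_scale bounded_ops_sum)
  qed (simp_all add: bounded_ops_on_zero[OF B bounded_ops_zero])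
qed

text \<open>Two bases are kept because \<open>Q\<close> and \<open>P\<close> need not commute. The
  unit traces are not assumed here; they enter only in \<open>sum_weight\<close> and
  \<open>sum_weight_ratio\<close>.\<close>

locale eigenbases =
  fixes Q P :: "'a :: complex_hilbert_space \<Rightarrow>\<^sub>L 'a"
    and E F :: "'a set" and q p :: "'a \<Rightarrow> real"
  assumes E: "is_onb E" "finite E" and F: "is_onb F" "finite F"
    and Q: "positive_op Q" and P: "positive_op P" and P_inv: "invertible_op P"
    and Q_eigen: "\<And>e. e \<in> E \<Longrightarrow> blinfun_apply Q e = q e *\<^sub>R e"
    and P_eigen: "\<And>f. f \<in> F \<Longrightarrow> blinfun_apply P f = p f *\<^sub>R f"
begin

lemma Q_bounded: "Q \<in> bounded_ops" and P_bounded: "P \<in> bounded_ops"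
  using Q P by (simp_all add: positive_op_def)

lemma E_norm: "e \<in> E \<Longrightarrow> norm e = 1" and F_norm: "f \<in> F \<Longrightarrow> norm f = 1"
  using E(1) F(1) orthonormal_norm[of E e] orthonormal_norm[of F f] by (simp_all add: is_onb_iff)

lemma q_nonneg: "e \<in> E \<Longrightarrow> 0 \<le> q e"
  using positive_op_inner_nonneg[OF Q, of e] by (simp add: Q_eigen dot_square_norm E_norm)

lemma p_pos: "f \<in> F \<Longrightarrow> 0 < p f"
proof -
  assume f: "f \<in> F"
  obtain S where "is_inverse_op P S"
    using P_inv by (auto simp: invertible_op_def)
  then obtain c where "c > 0" "c * (norm f)\<^sup>2 \<le> inner (blinfun_apply P f) f"
    using positive_invertible_bounded_below[OF P] by blast
  with f show ?thesis
    by (simp add: P_eigen dot_square_norm F_norm)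
qed

lemma is_inverse_inv_op: "is_inverse_op P (inv_op P)"
proof -
  have uniq: "S' = S" if "is_inverse_op P S" "is_inverse_op P S'" for S S'
  proof (rule blinfun_eqI)
    fix x
    have "blinfun_apply P (blinfun_apply S x) = x"
      using that(1) by (metis is_inverse_op_def blinfun_apply_blinfun_compose
          blinfun_apply_id_blinfun id_apply)
    moreover have "blinfun_apply S' (blinfun_apply P (blinfun_apply S x)) = blinfun_apply S x"
      using that(2) by (metis is_inverse_op_def blinfun_apply_blinfun_compose
          blinfun_apply_id_blinfun id_apply)
    ultimately show "blinfun_apply S' x = blinfun_apply S x"
      by simp
  qed
  obtain S where S: "is_inverse_op P S"
    using P_inv by (auto simp: invertible_op_def)
  then show ?thesis
    unfolding inv_op_def by (rule theI) (rule uniq[OF S])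
qed

lemma inv_op_bounded: "inv_op P \<in> bounded_ops"
  using is_inverse_inv_op by (simp add: is_inverse_op_def)

lemma inv_op_eigen:
  assumes "f \<in> F"
  shows "blinfun_apply (inv_op P) f = (1 / p f) *\<^sub>R f"
proof -
  have "blinfun_apply (inv_op P o\<^sub>L P) f = f"
    using is_inverse_inv_op by (simp add: is_inverse_op_def del: blinfun_apply_blinfun_compose)
  then have "p f *\<^sub>R blinfun_apply (inv_op P) f = f"
    by (simp add: P_eigen assms blinfun.scaleR_right)
  then have "(1 / p f) *\<^sub>R (p f *\<^sub>R blinfun_apply (inv_op P) f) = (1 / p f) *\<^sub>R f"
    by simp
  then show ?thesis
    using p_pos[OF assms] by simp
qed

text \<open>\<open>sqrt_op\<close> is a definite description. The diagonal operator \<open>R\<close>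
  is a positive root of \<open>P\<close>, and any other positive root agrees with it on
  \<open>F\<close>.\<close>

lemma sqrt_op_eigen:
  shows sqrt_op_bounded: "sqrt_op P \<in> bounded_ops"
    and "\<And>f. f \<in> F \<Longrightarrow> blinfun_apply (sqrt_op P) f = sqrt (p f) *\<^sub>R f"
proof -
  define R where "R = (\<Sum>f\<in>F. complex_of_real (sqrt (p f)) *\<^sub>C rank_one f f)"
  have R: "R \<in> bounded_ops"
    unfolding R_def by (intro bounded_ops_sum bounded_ops_scale) simp
  have R_apply: "blinfun_apply R x = (\<Sum>f\<in>F. (complex_of_real (sqrt (p f)) * cinner x f) *\<^sub>C f)" for x
    by (simp add: R_def blinfun.sum_left scaleC_blinfun.rep_eq rank_one.rep_eq scaleC_scaleC)
  have R_eigen: "blinfun_apply R f = sqrt (p f) *\<^sub>R f" if f: "f \<in> F" for f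
  proof (rule onb_eqI[OF F(1)])
    fix h assume "h \<in> F"
    with f show "cinner (blinfun_apply R f) h = cinner (sqrt (p f) *\<^sub>R f) h"
      using F orthonormalD[of F f h]
      by (simp add: R_apply orthonormal_coeff is_onb_iff cinner_scaleR_left)
  qed
  have "0 \<le> cinner (blinfun_apply R x) x" for x
  proof -
    have "cinner (blinfun_apply R x) x
      = (\<Sum>f\<in>F. complex_of_real (sqrt (p f)) * (cinner x f * cnj (cinner x f)))"
      unfolding R_apply cinner_sum_left cinner_scaleC_left
      by (subst cinner_commute[of _ x]) (simp add: mult.assoc)
    also have "\<dots> = complex_of_real (\<Sum>f\<in>F. sqrt (p f) * (cmod (cinner x f))\<^sup>2)"
      by (simp only: complex_norm_square[symmetric] of_real_sum of_real_mult)
    finally show ?thesis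
      using p_pos by (simp add: less_eq_complex_def sum_nonneg less_imp_le)
  qed
  then have R_pos: "positive_op R"
    using R by (simp add: positive_op_def)
  have R_sq: "R o\<^sub>L R = P"
  proof (rule bounded_ops_eqI[OF F bounded_ops_compose[OF R R] P_bounded])
    fix f assume "f \<in> F"
    then show "blinfun_apply (R o\<^sub>L R) f = blinfun_apply P f"
      using p_pos[of f] by (simp add: R_eigen P_eigen blinfun.scaleR_right)
  qed
  have "sqrt_op P = R"
    unfolding sqrt_op_def
  proof (rule the_equality)
    fix S assume S: "positive_op S \<and> S o\<^sub>L S = P"
    show "S = R"
    proof (rule bounded_ops_eqI[OF F _ R])
      show "S \<in> bounded_ops"
        using S by (simp add: positive_op_def)
      fix f assume f: "f \<in> F"
      \<comment> \<open>Since \<open>S\<close> squares to \<open>P\<close>, it maps \<open>y\<close>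
        to \<open>- sqrt (p f) *\<^sub>R y\<close>. A positive operator has no negative eigenvalue,
        so \<open>y = 0\<close>.\<close>
      define y where "y = blinfun_apply S f - sqrt (p f) *\<^sub>R f"
      have "blinfun_apply S (blinfun_apply S f) = p f *\<^sub>R f"
        using S P_eigen[OF f] by (metis blinfun_apply_blinfun_compose)
      then have "blinfun_apply S y = - sqrt (p f) *\<^sub>R y"
        using p_pos[OF f]
        by (simp add: y_def blinfun.diff_right blinfun.scaleR_right scaleR_diff_right)
      then have "sqrt (p f) * inner y y \<le> 0"
        using positive_op_inner_nonneg[of S y] S by simp
      moreover have "sqrt (p f) > 0"
        using p_pos[OF f] by simp
      ultimately have "inner y y \<le> 0"
        by (simp add: mult_le_0_iff)
      then have "y = 0"
        by (metis inner_gt_zero_iff not_less)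
      then show "blinfun_apply S f = blinfun_apply R f"
        by (simp add: y_def R_eigen f)
    qed
  qed (use R_pos R_sq in blast)
  then show "sqrt_op P \<in> bounded_ops"
    and "\<And>f. f \<in> F \<Longrightarrow> blinfun_apply (sqrt_op P) f = sqrt (p f) *\<^sub>R f"
    using R R_eigen by auto
qed

text \<open>Entrywise multiplication of the matrix of \<open>T\<close> with respect to
  \<open>F\<close> and \<open>E\<close>. The Araki transform, its polynomials, its resolvents and
  its functional calculus are all of this form.\<close>

definition coeff_mult :: "('a \<Rightarrow> 'a \<Rightarrow> complex) \<Rightarrow> ('a \<Rightarrow>\<^sub>L 'a) \<Rightarrow> ('a \<Rightarrow>\<^sub>L 'a)"
  where "coeff_mult c T =
    (\<Sum>(e, f)\<in>E \<times> F. (c e f * cinner (blinfun_apply T f) e) *\<^sub>C rank_one e f)"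

lemma coeff_mult_bounded: "coeff_mult c T \<in> bounded_ops"
  unfolding coeff_mult_def by (intro bounded_ops_sum) (auto intro!: bounded_ops_scale)

lemma coeff_mult_coeff:
  assumes "e \<in> E" "f \<in> F"
  shows "cinner (blinfun_apply (coeff_mult c T) f) e = c e f * cinner (blinfun_apply T f) e"
proof -
  have "blinfun_apply (coeff_mult c T) f =
    (\<Sum>d\<in>E. \<Sum>h\<in>F. (c d h * cinner (blinfun_apply T h) d * cinner f h) *\<^sub>C d)"
    unfolding coeff_mult_def sum.cartesian_product[symmetric]
    by (simp add: blinfun.sum_left scaleC_blinfun.rep_eq rank_one.rep_eq scaleC_scaleC)
  also have "\<dots> = (\<Sum>d\<in>E. \<Sum>h\<in>F. if h = f then (c d f * cinner (blinfun_apply T f) d) *\<^sub>C d else 0)"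
    using F assms(2) by (intro sum.cong refl) (auto simp: is_onb_iff orthonormalD)
  also have "\<dots> = (\<Sum>d\<in>E. (c d f * cinner (blinfun_apply T f) d) *\<^sub>C d)"
    using assms(2) F by simp
  finally show ?thesis
    using E assms(1) by (simp add: orthonormal_coeff is_onb_iff)
qed

lemma coeff_eqI:
  assumes "S \<in> bounded_ops" "T \<in> bounded_ops"
    and "\<And>e f. e \<in> E \<Longrightarrow> f \<in> F \<Longrightarrow> cinner (blinfun_apply S f) e = cinner (blinfun_apply T f) e"
  shows "S = T"
  using assms by (intro bounded_ops_eqI[OF F] onb_eqI[OF E(1)])

lemma rank_one_coeff:
  assumes "e \<in> E" "f \<in> F" "d \<in> E" "h \<in> F"
  shows "cinner (blinfun_apply (rank_one e f) h) d = (if d = e \<and> h = f then 1 else 0)"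
  using assms E F by (auto simp: rank_one.rep_eq cinner_scaleC_left is_onb_iff orthonormalD)

lemma coeff_mult_rank_one:
  assumes "e \<in> E" "f \<in> F"
  shows "coeff_mult c (rank_one e f) = c e f *\<^sub>C rank_one e f"
  by (rule coeff_eqI)
    (simp_all add: coeff_mult_bounded bounded_ops_scale coeff_mult_coeff rank_one_coeff assms
      scaleC_blinfun.rep_eq cinner_scaleC_left)

lemma hs_eq: "(hilbert_schmidt :: ('a \<Rightarrow>\<^sub>L 'a) set) = bounded_ops"
  by (rule hilbert_schmidt_eq_bounded_ops[OF E])

lemma hs_norm_coeff:
  assumes "T \<in> bounded_ops"
  shows "hs_norm T = sqrt (\<Sum>f\<in>F. \<Sum>e\<in>E. (cmod (cinner (blinfun_apply T f) e))\<^sup>2)"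
  by (simp add: hs_norm_onb[OF F assms] onb_norm_square[OF E])

text \<open>Lets convergence in the Hilbert-Schmidt norm be tested on single basis vectors.\<close>

lemma norm_le_hs_norm:
  assumes "T \<in> bounded_ops" "f \<in> F"
  shows "norm (blinfun_apply T f) \<le> hs_norm T"
  unfolding hs_norm_onb[OF F assms(1)]
  using member_le_sum[of f F "\<lambda>f. (norm (blinfun_apply T f))\<^sup>2"] assms(2) F(2)
  by (intro real_le_rsqrt) auto

lemma coeff_mult_in_bounded_ops_on:
  "(\<lambda>T\<in>bounded_ops. coeff_mult c T) \<in> bounded_ops_on bounded_ops hs_norm"
proof -
  \<comment> \<open>The sum of all squares dominates each of them and so serves in place of their
    maximum, also when there are none.\<close>
  define K where "K = (\<Sum>(e, f)\<in>E \<times> F. (cmod (c e f))\<^sup>2)"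
  have K: "(cmod (c e f))\<^sup>2 \<le> K" if "e \<in> E" "f \<in> F" for e f
    unfolding K_def
    using member_le_sum[of "(e, f)" "E \<times> F" "\<lambda>(e, f). (cmod (c e f))\<^sup>2"] that E(2) F(2)
    by auto
  have "hs_norm (coeff_mult c T) \<le> sqrt K * hs_norm T" if T: "T \<in> bounded_ops" for T
  proof -
    have "(\<Sum>f\<in>F. \<Sum>e\<in>E. (cmod (cinner (blinfun_apply (coeff_mult c T) f) e))\<^sup>2)
      \<le> (\<Sum>f\<in>F. \<Sum>e\<in>E. K * (cmod (cinner (blinfun_apply T f) e))\<^sup>2)"
      by (intro sum_mono) (simp add: coeff_mult_coeff norm_mult power_mult_distrib mult_right_mono K)
    then show ?thesis
      unfolding hs_norm_coeff[OF T] hs_norm_coeff[OF coeff_mult_bounded]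
      by (simp add: real_sqrt_mult[symmetric] sum_distrib_left)
  qed
  moreover have "coeff_mult c (S + T) = coeff_mult c S + coeff_mult c T"
    if "S \<in> bounded_ops" "T \<in> bounded_ops" for S T
    by (rule coeff_eqI)
      (simp_all add: that coeff_mult_bounded bounded_ops_add coeff_mult_coeff blinfun.add_left
        cinner_add_left distrib_left)
  moreover have "coeff_mult c (d *\<^sub>C T) = d *\<^sub>C coeff_mult c T" if "T \<in> bounded_ops" for d T
    by (rule coeff_eqI)
      (simp_all add: that coeff_mult_bounded bounded_ops_scale coeff_mult_coeff
        scaleC_blinfun.rep_eq cinner_scaleC_left)
  ultimately show ?thesis
    unfolding bounded_ops_on_def
    by (auto simp: coeff_mult_bounded bounded_ops_add bounded_ops_scale)
qed

section \<open>Spectrum and functional calculus of the Araki transform\<close>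

abbreviation ratio :: "'a \<Rightarrow> 'a \<Rightarrow> real"
  where "ratio e f \<equiv> q e / p f"

text \<open>At \<open>f\<close> the inverse of \<open>P\<close> contributes the factor
  \<open>1 / p f\<close>; moving the selfadjoint \<open>Q\<close> over to \<open>e\<close>
  contributes \<open>q e\<close>.\<close>

lemma araki_apply:
  assumes T: "T \<in> bounded_ops"
  shows "araki Q P T = coeff_mult (\<lambda>e f. complex_of_real (ratio e f)) T"
proof (rule coeff_eqI)
  have eq: "araki Q P T = Q o\<^sub>L T o\<^sub>L inv_op P"
    using T by (simp add: araki_def hs_eq)
  show "araki Q P T \<in> bounded_ops"
    unfolding eq by (intro bounded_ops_compose Q_bounded T inv_op_bounded)
  show "cinner (blinfun_apply (araki Q P T) f) e =
    cinner (blinfun_apply (coeff_mult (\<lambda>e f. complex_of_real (ratio e f)) T) f) e"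
    if "e \<in> E" "f \<in> F" for e f
    using that unfolding eq
    by (simp add: coeff_mult_coeff inv_op_eigen blinfun.scaleR_right cinner_scaleR_left
        positive_op_selfadjoint[OF Q] Q_eigen)
      (simp add: scaleR_scaleC cinner_scaleC_right)
qed (rule coeff_mult_bounded)

lemma poly_op_araki:
  assumes T: "T \<in> bounded_ops"
  shows "poly_op_on bounded_ops r (araki Q P) T
    = coeff_mult (\<lambda>e f. complex_of_real (poly r (ratio e f))) T"
proof -
  have pow: "(araki Q P ^^ i) T \<in> bounded_ops \<and> (\<forall>e\<in>E. \<forall>f\<in>F.
    cinner (blinfun_apply ((araki Q P ^^ i) T) f) e
      = complex_of_real (ratio e f ^ i) * cinner (blinfun_apply T f) e)" for i
  proof (induction i)
    case (Suc i)
    then have "(araki Q P ^^ Suc i) T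
      = coeff_mult (\<lambda>e f. complex_of_real (ratio e f)) ((araki Q P ^^ i) T)"
      by (simp add: araki_apply)
    with Suc show ?case
      by (simp add: coeff_mult_bounded coeff_mult_coeff)
  qed (simp add: T)
  show ?thesis
    using T pow
    by (intro coeff_eqI)
      (simp_all add: poly_op_on_def coeff_mult_bounded scaleR_scaleC bounded_ops_sum
        bounded_ops_scale coeff_mult_coeff blinfun.sum_left scaleC_blinfun.rep_eq cinner_sum_left
        cinner_scaleC_left poly_altdef sum_distrib_right mult.assoc)
qed

text \<open>Each ratio is an eigenvalue with eigenvector \<open>rank_one e f\<close>: a putative
  inverse \<open>B\<close> would send 0 to this nonzero operator. For any other real
  \<open>t\<close>, multiplying the coefficients by \<open>1 / (ratio e f - t)\<close> gives a
  bounded inverse.\<close>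

lemma spectrum_araki:
  "{t. complex_of_real t \<in> spectrum_on bounded_ops hs_norm (araki Q P)}
    = (\<lambda>(e, f). ratio e f) ` (E \<times> F)"
proof (intro equalityI subsetI)
  fix t assume "t \<in> (\<lambda>(e, f). ratio e f) ` (E \<times> F)"
  then obtain e f where ef: "e \<in> E" "f \<in> F" and t: "t = ratio e f" by auto
  have "\<not> (\<exists>B\<in>bounded_ops_on bounded_ops hs_norm. \<forall>x\<in>bounded_ops.
    araki Q P (B x) - complex_of_real t *\<^sub>C B x = x \<and>
    B (araki Q P x - complex_of_real t *\<^sub>C x) = x)"
  proof safe
    fix B assume B: "B \<in> bounded_ops_on bounded_ops hs_norm"
      and inv: "\<forall>x\<in>bounded_ops. araki Q P (B x) - complex_of_real t *\<^sub>C B x = x \<and>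
        B (araki Q P x - complex_of_real t *\<^sub>C x) = x"
    have "B (araki Q P (rank_one e f) - complex_of_real t *\<^sub>C rank_one e f) = rank_one e f"
      using inv by simp
    moreover have "araki Q P (rank_one e f) = complex_of_real t *\<^sub>C rank_one e f"
      by (simp add: araki_apply coeff_mult_rank_one ef t)
    ultimately have "rank_one e f = 0"
      using bounded_ops_on_zero[OF B bounded_ops_zero] by simp
    then show False
      using rank_one_coeff[OF ef ef] by simp
  qed
  then show "t \<in> {t. complex_of_real t \<in> spectrum_on bounded_ops hs_norm (araki Q P)}"
    by (simp add: spectrum_on_def)
next
  fix t assume "t \<in> {t. complex_of_real t \<in> spectrum_on bounded_ops hs_norm (araki Q P)}"
  then have spec: "\<not> (\<exists>B\<in>bounded_ops_on bounded_ops hs_norm. \<forall>x\<in>bounded_ops.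
    araki Q P (B x) - complex_of_real t *\<^sub>C B x = x \<and>
    B (araki Q P x - complex_of_real t *\<^sub>C x) = x)"
    by (simp add: spectrum_on_def)
  show "t \<in> (\<lambda>(e, f). ratio e f) ` (E \<times> F)"
  proof (rule ccontr)
    assume t: "t \<notin> (\<lambda>(e, f). ratio e f) ` (E \<times> F)"
    have ne: "ratio e f - t \<noteq> 0" if "e \<in> E" "f \<in> F" for e f
      using t that by force
    have inv: "complex_of_real (ratio e f - t) * complex_of_real (1 / (ratio e f - t)) = 1"
      "complex_of_real (1 / (ratio e f - t)) * complex_of_real (ratio e f - t) = 1"
      if "e \<in> E" "f \<in> F" for e f
      using ne[OF that] unfolding of_real_mult[symmetric] by simp_all
    define B where "B = (\<lambda>T\<in>bounded_ops. coeff_mult (\<lambda>e f. complex_of_real (1 / (ratio e f - t))) T)"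
    have diff: "araki Q P T - complex_of_real t *\<^sub>C T
      = coeff_mult (\<lambda>e f. complex_of_real (ratio e f - t)) T" (is "?L = _")
      if T: "T \<in> bounded_ops" for T
    proof (rule coeff_eqI)
      have "?L = araki Q P T + complex_of_real (- t) *\<^sub>C T"
        by (simp add: scaleC_minus_left)
      then show "?L \<in> bounded_ops"
        using T by (simp only: araki_apply coeff_mult_bounded bounded_ops_scale bounded_ops_add)
    qed (use T in \<open>simp_all add: coeff_mult_bounded araki_apply blinfun.diff_left
        cinner_diff_left coeff_mult_coeff scaleC_blinfun.rep_eq cinner_scaleC_left left_diff_distrib\<close>)
    have "araki Q P (B x) - complex_of_real t *\<^sub>C B x = x \<and>
      B (araki Q P x - complex_of_real t *\<^sub>C x) = x" if x: "x \<in> bounded_ops" for x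
    proof -
      have "coeff_mult (\<lambda>e f. complex_of_real (ratio e f - t)) (B x) = x"
        using x inv by (intro coeff_eqI)
          (simp_all add: B_def coeff_mult_bounded coeff_mult_coeff mult.assoc[symmetric]
            del: of_real_diff of_real_divide)
      moreover have "B (coeff_mult (\<lambda>e f. complex_of_real (ratio e f - t)) x) = x"
        using x inv by (intro coeff_eqI)
          (simp_all add: B_def coeff_mult_bounded coeff_mult_coeff mult.assoc[symmetric]
            del: of_real_diff of_real_divide)
      moreover have "B x \<in> bounded_ops"
        using x by (simp add: B_def coeff_mult_bounded)
      ultimately show ?thesis
        using x by (simp add: diff)
    qed
    moreover have "B \<in> bounded_ops_on bounded_ops hs_norm"
      unfolding B_def by (rule coeff_mult_in_bounded_ops_on)
    ultimately show False
      using spec by blast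
  qed
qed

text \<open>The spectrum is finite, so a constant sequence of interpolating polynomials shows that
  the right side qualifies. Conversely, any admissible limit \<open>B\<close> is forced on the
  matrix units, and linearity and extensionality determine the rest.\<close>

lemma cfc_araki:
  "cfc_on hilbert_schmidt hs_norm g (araki Q P)
    = (\<lambda>T\<in>bounded_ops. coeff_mult (\<lambda>e f. complex_of_real (g (ratio e f))) T)"
  unfolding cfc_on_def hs_eq spectrum_araki
proof (rule the_equality)
  let ?L = "(\<lambda>(e, f). ratio e f) ` (E \<times> F)"
  let ?B = "\<lambda>T\<in>bounded_ops. coeff_mult (\<lambda>e f. complex_of_real (g (ratio e f))) T"
  obtain r where r: "\<forall>t\<in>?L. poly r t = g t"
    using polynomial_interpolation[of ?L g] E(2) F(2) by auto
  have "uniform_limit ?L (\<lambda>n :: nat. poly r) g sequentially"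
    using r by (simp add: uniform_limit_iff)
  moreover have "op_norm_tendsto bounded_ops hs_norm (\<lambda>n. poly_op_on bounded_ops r (araki Q P)) ?B"
    unfolding op_norm_tendsto_def
  proof (intro allI impI always_eventually ballI)
    fix \<epsilon> :: real and T :: "'a \<Rightarrow>\<^sub>L 'a" assume "\<epsilon> > 0" and T: "T \<in> bounded_ops"
    have "poly_op_on bounded_ops r (araki Q P) T = ?B T"
      unfolding poly_op_araki[OF T]
      using r T by (intro coeff_eqI) (simp_all add: coeff_mult_bounded coeff_mult_coeff)
    moreover have "hs_norm (0 :: 'a \<Rightarrow>\<^sub>L 'a) = 0" and "0 \<le> hs_norm T"
      using hs_norm_onb[OF F bounded_ops_zero] hs_norm_onb[OF F T] by (simp_all add: sum_nonneg)
    ultimately show "hs_norm (poly_op_on bounded_ops r (araki Q P) T - ?B T) \<le> \<epsilon> * hs_norm T"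
      using \<open>\<epsilon> > 0\<close> by simp
  qed
  ultimately show "?B \<in> bounded_ops_on bounded_ops hs_norm \<and>
    (\<exists>r. uniform_limit ?L (\<lambda>n. poly (r n)) g sequentially \<and>
      op_norm_tendsto bounded_ops hs_norm (\<lambda>n. poly_op_on bounded_ops (r n) (araki Q P)) ?B)"
    using coeff_mult_in_bounded_ops_on by (intro conjI exI[of _ "\<lambda>_. r"])
next
  let ?L = "(\<lambda>(e, f). ratio e f) ` (E \<times> F)"
  let ?D = "\<lambda>T\<in>bounded_ops. coeff_mult (\<lambda>e f. complex_of_real (g (ratio e f))) T"
  fix B
  assume "B \<in> bounded_ops_on bounded_ops hs_norm \<and>
    (\<exists>r. uniform_limit ?L (\<lambda>n. poly (r n)) g sequentially \<and>
      op_norm_tendsto bounded_ops hs_norm (\<lambda>n. poly_op_on bounded_ops (r n) (araki Q P)) B)"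
  then obtain r where B: "B \<in> bounded_ops_on bounded_ops hs_norm"
    and unif: "uniform_limit ?L (\<lambda>n. poly (r n)) g sequentially"
    and lim: "op_norm_tendsto bounded_ops hs_norm (\<lambda>n. poly_op_on bounded_ops (r n) (araki Q P)) B"
    by blast
  have B_mem: "B T \<in> bounded_ops" if "T \<in> bounded_ops" for T
    using B that by (auto simp: bounded_ops_on_def)
  have B_rank_one: "B (rank_one e f) = complex_of_real (g (ratio e f)) *\<^sub>C rank_one e f"
    if ef: "e \<in> E" "f \<in> F" for e f
  proof (rule bounded_ops_eqI[OF F B_mem[OF rank_one_in_bounded_ops]])
    show "complex_of_real (g (ratio e f)) *\<^sub>C rank_one e f \<in> bounded_ops"
      by (simp add: bounded_ops_scale)
    fix h assume h: "h \<in> F"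
    let ?K = "rank_one e f"
    have hK: "0 \<le> hs_norm ?K"
      by (simp add: hs_norm_onb[OF F] sum_nonneg)
    have "(\<lambda>n. poly (r n) (ratio e f)) \<longlonglongrightarrow> g (ratio e f)"
      using tendsto_uniform_limitI[OF unif] ef by auto
    then have "(\<lambda>n. poly (r n) (ratio e f) *\<^sub>R blinfun_apply ?K h)
      \<longlonglongrightarrow> g (ratio e f) *\<^sub>R blinfun_apply ?K h"
      by (intro tendsto_intros)
    \<comment> \<open>On \<open>rank_one e f\<close> the polynomials act as scalars. Their values
      converge to \<open>g (ratio e f)\<close> by uniform convergence on the spectrum, while
      convergence in operator norm gives the limit \<open>B ?K\<close>; the two limits at
      \<open>h\<close> must agree.\<close>
    moreover have "(\<lambda>n. poly (r n) (ratio e f) *\<^sub>R blinfun_apply ?K h) \<longlonglongrightarrow> blinfun_apply (B ?K) h"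
    proof (rule tendstoI)
      fix \<delta> :: real assume "\<delta> > 0"
      \<comment> \<open>The \<open>+ 1\<close> keeps the denominator positive and makes the final
        bound strictly smaller than \<delta>.\<close>
      define \<epsilon> where "\<epsilon> = \<delta> / (hs_norm ?K + 1)"
      have "\<epsilon> > 0"
        using \<open>\<delta> > 0\<close> hK by (simp add: \<epsilon>_def)
      have "\<epsilon> * hs_norm ?K < \<epsilon> * (hs_norm ?K + 1)"
        using \<open>\<epsilon> > 0\<close> by simp
      also have "\<dots> = \<delta>"
        using hK by (simp add: \<epsilon>_def)
      finally have small: "\<epsilon> * hs_norm ?K < \<delta>" .
      have "\<forall>\<^sub>F n in sequentially. \<forall>T\<in>bounded_ops.
        hs_norm (poly_op_on bounded_ops (r n) (araki Q P) T - B T) \<le> \<epsilon> * hs_norm T"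
        using lim \<open>\<epsilon> > 0\<close> by (simp add: op_norm_tendsto_def)
      then show "\<forall>\<^sub>F n in sequentially.
        dist (poly (r n) (ratio e f) *\<^sub>R blinfun_apply ?K h) (blinfun_apply (B ?K) h) < \<delta>"
      proof eventually_elim
        case (elim n)
        have eq: "poly_op_on bounded_ops (r n) (araki Q P) ?K
          = complex_of_real (poly (r n) (ratio e f)) *\<^sub>C ?K"
          by (simp add: poly_op_araki coeff_mult_rank_one ef)
        let ?X = "complex_of_real (poly (r n) (ratio e f)) *\<^sub>C ?K - B ?K"
        have "?X = complex_of_real (poly (r n) (ratio e f)) *\<^sub>C ?K + (- 1) *\<^sub>C B ?K"
          by (simp add: scaleC_minus_left)
        then have "?X \<in> bounded_ops"
          by (simp only: bounded_ops_add bounded_ops_scale rank_one_in_bounded_ops B_mem)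
        then have "norm (blinfun_apply ?X h) \<le> hs_norm ?X"
          using h by (rule norm_le_hs_norm)
        also have "\<dots> \<le> \<epsilon> * hs_norm ?K"
          using elim eq by (metis rank_one_in_bounded_ops)
        finally show ?case
          using small by (simp add: dist_norm blinfun.diff_left scaleC_blinfun.rep_eq scaleR_scaleC)
      qed
    qed
    ultimately have "blinfun_apply (B ?K) h = g (ratio e f) *\<^sub>R blinfun_apply ?K h"
      using LIMSEQ_unique by blast
    then show "blinfun_apply (B ?K) h
      = blinfun_apply (complex_of_real (g (ratio e f)) *\<^sub>C ?K) h"
      by (simp add: scaleC_blinfun.rep_eq scaleR_scaleC)
  qed
  show "B = ?D"
  proof (rule extensionalityI[where A = bounded_ops])
    show "B \<in> extensional bounded_ops"
      using B by (auto simp: bounded_ops_on_def PiE_def)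
    fix T :: "'a \<Rightarrow>\<^sub>L 'a" assume T: "T \<in> bounded_ops"
    \<comment> \<open>With all multipliers equal to 1, \<open>coeff_mult\<close> is the expansion of
      \<open>T\<close> in matrix units.\<close>
    have "T = coeff_mult (\<lambda>_ _. 1) T"
      using T by (intro coeff_eqI) (simp_all add: coeff_mult_bounded coeff_mult_coeff)
    then have "B T = B (\<Sum>z\<in>E \<times> F. cinner (blinfun_apply T (snd z)) (fst z) *\<^sub>C
        rank_one (fst z) (snd z))"
      by (simp add: coeff_mult_def case_prod_unfold)
    also have "\<dots> = (\<Sum>z\<in>E \<times> F. cinner (blinfun_apply T (snd z)) (fst z) *\<^sub>C
        B (rank_one (fst z) (snd z)))"
      by (rule bounded_ops_on_sum[OF B]) simp
    also have "\<dots> = ?D T"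
      using T by (auto simp: coeff_mult_def case_prod_unfold B_rank_one scaleC_scaleC mult.commute
          intro!: sum.cong)
    finally show "B T = ?D T" .
  qed simp
qed

section \<open>The divergence as a mean over a probability distribution\<close>

definition weight :: "'a \<Rightarrow> 'a \<Rightarrow> real"
  where "weight e f = p f * (cmod (cinner f e))\<^sup>2"

lemma weight_nonneg: "f \<in> F \<Longrightarrow> 0 \<le> weight e f"
  using p_pos by (simp add: weight_def less_imp_le)

text \<open>The coefficient of \<open>sqrt_op P\<close> at \<open>e\<close> and \<open>f\<close> is
  \<open>sqrt (p f) * cinner f e\<close>, whose squared modulus is \<open>weight e f\<close>. The
  functional calculus multiplies this coefficient by \<open>g (ratio e f)\<close> in one of the two
  factors of the product.\<close>

lemma quantum_divergence_eq:
  "quantum_divergence g Q P = complex_of_real (\<Sum>(e, f)\<in>E \<times> F. weight e f * g (ratio e f))"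
proof -
  let ?R = "sqrt_op P"
  let ?D = "coeff_mult (\<lambda>e f. complex_of_real (g (ratio e f))) ?R"
  have "quantum_divergence g Q P = hs_inner ?D ?R"
    by (simp add: quantum_divergence_def cfc_araki sqrt_op_bounded)
  also have "\<dots> = (\<Sum>f\<in>F. \<Sum>e\<in>E.
      cinner (blinfun_apply ?D f) e * cnj (cinner (blinfun_apply ?R f) e))"
    unfolding hs_inner_onb[OF F coeff_mult_bounded sqrt_op_bounded]
    by (intro sum.cong refl onb_parseval[OF E])
  also have "\<dots> = (\<Sum>f\<in>F. \<Sum>e\<in>E. complex_of_real (weight e f * g (ratio e f)))"
  proof (intro sum.cong refl)
    fix e f assume ef: "e \<in> E" "f \<in> F"
    have "complex_of_real (sqrt (p f)) * complex_of_real (sqrt (p f)) = complex_of_real (p f)"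
      using p_pos[OF ef(2)] by (simp flip: of_real_mult)
    then show "cinner (blinfun_apply ?D f) e * cnj (cinner (blinfun_apply ?R f) e)
      = complex_of_real (weight e f * g (ratio e f))"
      unfolding coeff_mult_coeff[OF ef] sqrt_op_eigen(2)[OF ef(2)] cinner_scaleR_left weight_def
        of_real_mult complex_norm_square
      by (simp add: algebra_simps)
  qed
  also have "\<dots> = (\<Sum>e\<in>E. \<Sum>f\<in>F. complex_of_real (weight e f * g (ratio e f)))"
    by (rule sum.swap)
  finally show ?thesis
    by (simp add: sum.cartesian_product case_prod_unfold)
qed

text \<open>Parseval for each \<open>f\<close> in the basis \<open>E\<close> leaves the sum of the
  eigenvalues of \<open>P\<close>.\<close>

lemma sum_weight:
  assumes "tr P = 1"
  shows "(\<Sum>(e, f)\<in>E \<times> F. weight e f) = 1"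
proof -
  have "(\<Sum>(e, f)\<in>E \<times> F. weight e f) = (\<Sum>f\<in>F. \<Sum>e\<in>E. weight e f)"
    unfolding sum.cartesian_product[symmetric] by (rule sum.swap)
  also have "\<dots> = (\<Sum>f\<in>F. p f)"
    by (intro sum.cong refl)
      (simp add: weight_def sum_distrib_left[symmetric] onb_norm_square[OF E, symmetric] F_norm)
  also have "complex_of_real \<dots> = tr P"
    unfolding tr_onb[OF F P_bounded]
    by (simp add: P_eigen cinner_scaleR_left cinner_self F_norm)
  finally show ?thesis
    using assms by (simp only: of_real_eq_1_iff)
qed

text \<open>The factor \<open>p f\<close> cancels, and Parseval for each \<open>e\<close> in the
  basis \<open>F\<close> leaves the sum of the eigenvalues of \<open>Q\<close>.\<close>

lemma sum_weight_ratio: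
  assumes "tr Q = 1"
  shows "(\<Sum>(e, f)\<in>E \<times> F. weight e f * ratio e f) = 1"
proof -
  have "(\<Sum>(e, f)\<in>E \<times> F. weight e f * ratio e f)
    = (\<Sum>e\<in>E. \<Sum>f\<in>F. q e * (cmod (cinner e f))\<^sup>2)"
    unfolding sum.cartesian_product[symmetric] weight_def
    using p_pos by (intro sum.cong refl) (fastforce simp: cmod_cinner_commute)
  also have "\<dots> = (\<Sum>e\<in>E. q e)"
    by (intro sum.cong refl)
      (simp add: sum_distrib_left[symmetric] onb_norm_square[OF F, symmetric] E_norm)
  also have "complex_of_real \<dots> = tr Q"
    unfolding tr_onb[OF E Q_bounded]
    by (simp add: Q_eigen cinner_scaleR_left cinner_self E_norm)
  finally show ?thesis
    using assms by (simp only: of_real_eq_1_iff)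
qed

lemma ratio_nonneg: "e \<in> E \<Longrightarrow> f \<in> F \<Longrightarrow> 0 \<le> ratio e f"
  using q_nonneg p_pos by (simp add: less_imp_le)

end

section \<open>Tangent inequality and conclusion\<close>

lemma convex_tangent_halfline:
  fixes f f' :: "real \<Rightarrow> real"
  assumes conv: "convex_on {0..} f"
    and deriv: "\<And>t. t \<ge> 0 \<Longrightarrow> (f has_real_derivative f' t) (at t within {0..})"
    and cont: "continuous_on {0..} f'"
    and "s \<ge> 0" "t \<ge> 0"
  shows "f' t * (s - t) \<le> f s - f t"
proof (cases "t = 0")
  case False
  then have "f s - f t \<ge> f' t * (s - t)"
    using assms by (intro convex_on_imp_above_tangent[where A = "{0..}"]) auto
  then show ?thesis by simp
next
  \<comment> \<open>The endpoint 0 is not interior to the half-line, where the tangent inequality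
    for convex functions applies. It is reached as the limit from the right, using the continuity of
    \<open>f\<close> and \<open>f'\<close>. A ratio can be 0, since \<open>Q\<close> may have a
    kernel.\<close>
  case True
  have "continuous_on {0..} f"
    by (rule DERIV_continuous_on) (use deriv in auto)
  then have lims: "(f \<longlongrightarrow> f 0) (at_right 0)" "(f' \<longlongrightarrow> f' 0) (at_right 0)"
    using cont by (auto simp: continuous_on_def intro: tendsto_within_subset)
  then have "((\<lambda>t. f s - f t) \<longlongrightarrow> f s - f 0) (at_right 0)"
    and "((\<lambda>t. f' t * (s - t)) \<longlongrightarrow> f' 0 * (s - 0)) (at_right 0)"
    by (intro tendsto_intros lims)+
  moreover have "\<forall>\<^sub>F t in at_right 0. f' t * (s - t) \<le> f s - f t"
    using eventually_at_right_less[of 0]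
  proof eventually_elim
    case (elim t)
    then show ?case
      using assms by (intro convex_on_imp_above_tangent[where A = "{0..}"]) auto
  qed
  ultimately show ?thesis
    using True tendsto_le[OF trivial_limit_at_right_real] by blast
qed

lemma positive_op_eigenbasis:
  fixes T :: "'a :: complex_hilbert_space \<Rightarrow>\<^sub>L 'a" and D :: "'a set"
  assumes "is_onb D" "finite D" "positive_op T"
  obtains E q where "is_onb E" "finite E" "\<And>e. e \<in> E \<Longrightarrow> blinfun_apply T e = q e *\<^sub>R e"
  using selfadjoint_eigenbasis[OF assms(1,2) positive_op_selfadjoint[OF assms(3)]]
  by (metis (no_types, lifting))

theorem theorem7:
  fixes f :: "real \<Rightarrow> real"
    and Q P :: "'a :: complex_hilbert_space \<Rightarrow>\<^sub>L 'a"
  assumes "continuous_on {0..} f"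
    and "convex_on {0..} f"
    and "f 1 = 0"
    and "Q \<in> density_ops"
    and "P \<in> density_ops"
    and "invertible_op P"
  shows "0 \<le> quantum_divergence f Q P \<and>
    (\<forall>f' :: real \<Rightarrow> real.
      (\<forall>t\<ge>0. (f has_real_derivative f' t) (at t within {0..})) \<and> continuous_on {0..} f' \<longrightarrow>
      quantum_divergence f Q P
        \<le> quantum_divergence (\<lambda>t. t * f' t) Q P - quantum_divergence f' Q P)"
proof -
  have Q_dens: "positive_op Q" "tr Q = 1" and P_dens: "positive_op P" "tr P = 1"
    using assms by (auto simp: density_ops_def)
  \<comment> \<open>Any finite basis will do here: it certifies finite dimension and lets both
    operators be diagonalized.\<close>
  obtain D :: "'a set" where D: "is_onb D" "finite D"
    using invertible_density_finite_onb assms by blast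
  obtain E q where E: "is_onb E" "finite E" "\<And>e. e \<in> E \<Longrightarrow> blinfun_apply Q e = q e *\<^sub>R e"
    using positive_op_eigenbasis[OF D Q_dens(1)] by blast
  obtain F p where F: "is_onb F" "finite F" "\<And>e. e \<in> F \<Longrightarrow> blinfun_apply P e = p e *\<^sub>R e"
    using positive_op_eigenbasis[OF D P_dens(1)] by blast
  interpret eigenbases Q P E F q p
    by unfold_locales (use E F Q_dens P_dens assms in auto)
  let ?w = "\<lambda>z. weight (fst z) (snd z)" and ?r = "\<lambda>z. ratio (fst z) (snd z)"
  have w: "sum ?w (E \<times> F) = 1" "(\<Sum>z\<in>E \<times> F. ?w z * ?r z) = 1"
    using sum_weight[OF P_dens(2)] sum_weight_ratio[OF Q_dens(2)] by (simp_all add: case_prod_unfold)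
  \<comment> \<open>The divergences are real, so the inequalities in the order of
    \<open>complex\<close>, which demand equal imaginary parts, reduce to real ones.\<close>
  have S: "quantum_divergence g Q P = complex_of_real (\<Sum>z\<in>E \<times> F. ?w z * g (?r z))" for g
    by (simp add: quantum_divergence_eq case_prod_unfold)
  have "f (\<Sum>z\<in>E \<times> F. ?w z *\<^sub>R ?r z) \<le> (\<Sum>z\<in>E \<times> F. ?w z * f (?r z))"
  proof (rule convex_on_sum[OF _ _ assms(2) w(1)])
    \<comment> \<open>An empty family of weights would have sum 0.\<close>
    show "E \<times> F \<noteq> {}"
      using w(1) by auto
  qed (use E F weight_nonneg ratio_nonneg in auto)
  then have "0 \<le> quantum_divergence f Q P"
    unfolding S using w(2) assms(3) by (simp add: less_eq_complex_def)
  moreover have "quantum_divergence f Q P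
      \<le> quantum_divergence (\<lambda>t. t * f' t) Q P - quantum_divergence f' Q P"
    if f': "\<And>t. t \<ge> 0 \<Longrightarrow> (f has_real_derivative f' t) (at t within {0..})"
      "continuous_on {0..} f'" for f'
  proof -
    have "(\<Sum>z\<in>E \<times> F. ?w z * f (?r z)) \<le> (\<Sum>z\<in>E \<times> F. ?w z * (?r z * f' (?r z) - f' (?r z)))"
    proof (intro sum_mono mult_left_mono)
      fix z assume z: "z \<in> E \<times> F"
      then show "0 \<le> ?w z"
        by (auto intro: weight_nonneg)
      have "0 \<le> ?r z"
        using z ratio_nonneg by auto
      \<comment> \<open>The tangent is taken at the ratio and evaluated at 1, where \<open>f\<close>
        vanishes.\<close>
      then have "f' (?r z) * (1 - ?r z) \<le> f 1 - f (?r z)"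
        by (intro convex_tangent_halfline[OF assms(2) f']) auto
      then show "f (?r z) \<le> ?r z * f' (?r z) - f' (?r z)"
        using assms(3) by (simp add: algebra_simps)
    qed
    then show ?thesis
      unfolding S of_real_diff[symmetric] less_eq_complex_def
      by (simp add: sum_subtractf right_diff_distrib)
  qed
  ultimately show ?thesis
    by blast
qed

end
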